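(* Let $1<p<\infty$, $p\neq 2$, and let $g$ be a continuous function belonging to the Wiener amalgam space $W$. Let $T\subset\mathbb R$ be a uniformly discrete set and $\Lambda\subset T\times\mathbb R$ a countable set. Then there do not exist functionals $g^*_{ts}\in(L^p(\mathbb R))^*$, $(t,s)\in\Lambda$, such that $\{(e_s\tau_t g,\,g^*_{ts}):(t,s)\in\Lambda\}$ is an unconditional Schauder frame of $L^p(\mathbb R)$.
   Context: For $t,s\in\mathbb R$ write $(\tau_t g)(x)=g(x-t)$ and $e_s(x)=e^{2\pi i s x}$. The Wiener amalgam space $W=W(L^\infty,\ell^1)$ consists of measurable $g$ on $\mathbb R$ with $\|g\|_W=\sum_{k\in\mathbb Z}\|g|_{[k,k+1]}\|_\infty<\infty$. A set $T\subset\mathbb R$ is uniformly discrete if $\inf\{|t-t'|:t,t'\in T,\ t\ne t'\}>0$. A family $\{(u_n,u_n^* )\}_{n\in N}\subset X\times X^*$ (countable index set $N$) is an unconditional Schauder frame of the Banach space $X$ if for every $x\in X$ the series $\sum_{n}u_n^*(x)u_n$ converges unconditionally to $x$. *)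

theory Defs
  imports "HOL-Probability.Probability"
begin

definition transl :: "real \<Rightarrow> (real \<Rightarrow> complex) \<Rightarrow> real \<Rightarrow> complex" where
  "transl t g = (\<lambda>x. g (x - t))"

definition modul :: "real \<Rightarrow> real \<Rightarrow> complex" where
  "modul s = (\<lambda>x. exp (2 * pi * \<i> * complex_of_real (s * x)))"

definition wiener_amalgam :: "(real \<Rightarrow> complex) \<Rightarrow> bool" where
  "wiener_amalgam g \<longleftrightarrow> g \<in> borel_measurable lebesgue \<and>
     (\<Sum>\<^sub>\<infinity>k::int. esssup (restrict_space lebesgue {real_of_int k .. real_of_int k + 1})
                         (\<lambda>x. ennreal (cmod (g x)))) < \<infinity>"

definition uniformly_discrete :: "real set \<Rightarrow> bool" where
  "uniformly_discrete T \<longleftrightarrow> (\<exists>\<delta>>0. \<forall>t\<in>T. \<forall>t'\<in>T. t \<noteq> t' \<longrightarrow> \<delta> \<le> \<bar>t - t'\<bar>)"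

definition Lp :: "real \<Rightarrow> (real \<Rightarrow> complex) set" where
  "Lp p = {f. f \<in> borel_measurable lebesgue \<and> integrable lebesgue (\<lambda>x. cmod (f x) powr p)}"

definition lp_norm :: "real \<Rightarrow> (real \<Rightarrow> complex) \<Rightarrow> real" where
  "lp_norm p f = (\<integral>x. cmod (f x) powr p \<partial>lebesgue) powr (1 / p)"

text \<open>The dual (L^p)^*: bounded complex-linear functionals on L^p (only their values on L^p matter;
  boundedness forces them to respect equality almost everywhere).\<close>
definition Lp_dual :: "real \<Rightarrow> ((real \<Rightarrow> complex) \<Rightarrow> complex) set" where
  "Lp_dual p = {\<phi>. (\<forall>f\<in>Lp p. \<forall>h\<in>Lp p. \<forall>a b::complex.
                      \<phi> (\<lambda>x. a * f x + b * h x) = a * \<phi> f + b * \<phi> h) \<and>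
                  (\<exists>C. \<forall>f\<in>Lp p. cmod (\<phi> f) \<le> C * lp_norm p f)}"

definition unconditional_schauder_frame ::
  "real \<Rightarrow> 'n set \<Rightarrow> ('n \<Rightarrow> real \<Rightarrow> complex) \<Rightarrow> ('n \<Rightarrow> (real \<Rightarrow> complex) \<Rightarrow> complex) \<Rightarrow> bool" where
  "unconditional_schauder_frame p N u ustar \<longleftrightarrow>
     (\<forall>n\<in>N. u n \<in> Lp p \<and> ustar n \<in> Lp_dual p) \<and>
     (\<forall>f\<in>Lp p. \<forall>\<epsilon>>0. \<exists>F0. finite F0 \<and> F0 \<subseteq> N \<and>
        (\<forall>F. finite F \<and> F0 \<subseteq> F \<and> F \<subseteq> N \<longrightarrow>
             lp_norm p (\<lambda>x. f x - (\<Sum>n\<in>F. ustar n f * u n x)) < \<epsilon>))"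

end

theory Submission
  imports Defs
begin

text \<open>Near a point where \<open>g\<close> does not vanish, multiplying the coefficients of the exponentials \<open>e\<^sub>s\<close> attached
  to a fixed \<open>t\<close> by suitable unimodular constants translates their sum, and unconditionality makes this
  harmless. Hence on a short interval each \<open>\<tau>\<^sub>t g\<close> can be replaced by the constant \<open>g (- t)\<close>, the errors being
  summable and small by continuity, the amalgam condition and the discreteness of \<open>T\<close>. What remains is an
  unconditional expansion in multiples of exponentials, up to a small multiple of the identity. Now cut
  the interval into \<open>N\<close> equal pieces: exponentials pair with all their indicators with the same modulus, so
  by Khintchine's inequality a random signed sum of the \<open>N\<close> indicators has pairings \<open>\<surd>N\<close> times larger than
  one of them. Comparing norms in \<open>L\<^sup>p\<close> and in the dual space \<open>L\<^sup>q\<close> gives \<open>N powr (1/p - 1/2)\<close>, respectively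
  \<open>N powr (1/q - 1/2)\<close>, bounded, which is absurd for one of the two when \<open>p \<noteq> 2\<close>.\<close>

section \<open>The spaces \<open>L\<^sup>p\<close>\<close>

text \<open>Unconditionality is used only through the bound of sums of |c_n(f)| |<u_n, h>| over
  finite index sets by K ||f||_p ||h||_q. Since moduli stand inside the sum, the test function
  \<open>h\<close> may be changed whenever the moduli of the pairings stay under control.
  Translating \<open>h\<close> does this for the exponentials of one \<open>t\<close>, by an amount
  depending on \<open>t\<close>. Different \<open>t\<close> ask for different test functions, so the
  bound is applied once per \<open>t\<close> and the results are added. This is why l^1 control over
  \<open>t\<close> is needed; the amalgam norm and the separation of \<open>T\<close> provide it.

  Freezing the windows leaves an error of 1/4 ||f||_p ||h||_q, which could exceed <f, h> for general
  \<open>f\<close> and \<open>h\<close>. It is only tested on f = h = the indicator of an interval,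
  where Hoelder's inequality is an equality, so a fixed proportion of the pairing survives.

  The constant K comes from a uniform boundedness principle for seminorms on functions, as the
  elements of \<open>Lp p\<close> are functions rather than classes.\<close>

lemma powr_convex_comb:
  fixes x y u v p :: real
  assumes "1 \<le> p" "0 \<le> x" "0 \<le> y" "0 < u" "0 < v" "u + v = 1"
  shows "(u * x + v * y) powr p \<le> u * x powr p + v * y powr p"
proof -
  have scale: "(w * z) powr p \<le> w * z powr p" if "0 < w" "w \<le> 1" "0 \<le> z" for w z :: real
  proof -
    have "w powr p \<le> w powr 1"
      using that assms(1) by (intro powr_mono') auto
    then show ?thesis
      using that by (simp add: powr_mult mult_right_mono)
  qed
  consider "x = 0" | "y = 0" | "0 < x" "0 < y"
    using assms by linarith
  then show ?thesis
  proof cases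
    case 1
    then show ?thesis using scale[of v y] assms by simp
  next
    case 2
    then show ?thesis using scale[of u x] assms by simp
  next
    case 3
    have "(\<lambda>x. x powr p) ((1 - v) *\<^sub>R x + v *\<^sub>R y) \<le> (1 - v) * x powr p + v * y powr p"
      by (rule convex_onD[OF powr_convex]) (use assms 3 in auto)
    moreover have "1 - v = u" using assms by simp
    ultimately show ?thesis by simp
  qed
qed

lemma Lp_measurable: "f \<in> Lp p \<Longrightarrow> f \<in> borel_measurable lebesgue"
  by (simp add: Lp_def)

lemma Lp_integrable: "f \<in> Lp p \<Longrightarrow> integrable lebesgue (\<lambda>x. cmod (f x) powr p)"
  by (simp add: Lp_def)

lemma lp_norm_nonneg: "0 \<le> lp_norm p f"
  by (simp add: lp_norm_def)

lemma lp_norm_powr: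
  assumes "0 < p" shows "lp_norm p f powr p = (\<integral>x. cmod (f x) powr p \<partial>lebesgue)"
  using assms by (simp add: lp_norm_def powr_powr integral_nonneg_AE)

lemma lp_norm_leI:
  assumes "0 < p" "0 \<le> C" "(\<integral>x. cmod (f x) powr p \<partial>lebesgue) \<le> C powr p"
  shows "lp_norm p f \<le> C"
proof -
  have "lp_norm p f \<le> (C powr p) powr (1 / p)"
    unfolding lp_norm_def using assms by (intro powr_mono2) (auto simp: integral_nonneg_AE)
  then show ?thesis using assms by (simp add: powr_powr)
qed

lemma integral_powr_le:
  assumes "0 < p" "lp_norm p f \<le> A"
  shows "(\<integral>x. cmod (f x) powr p \<partial>lebesgue) \<le> A powr p"
  using powr_mono2[of p "lp_norm p f" A] assms by (simp add: lp_norm_powr lp_norm_nonneg)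

lemma Lp_zero: "(\<lambda>x. 0) \<in> Lp p"
  by (simp add: Lp_def)

lemma lp_norm_zero: "0 < p \<Longrightarrow> lp_norm p (\<lambda>x. 0) = 0"
  by (simp add: lp_norm_def)

lemma Lp_cmult: "f \<in> Lp p \<Longrightarrow> (\<lambda>x. a * f x) \<in> Lp p"
  by (auto simp: Lp_def norm_mult powr_mult)

lemma lp_norm_cmult:
  assumes "0 < p" shows "lp_norm p (\<lambda>x. a * f x) = cmod a * lp_norm p f"
  using assms by (simp add: lp_norm_def norm_mult powr_mult powr_powr integral_nonneg_AE)

lemma lp_norm_minus: "lp_norm p (\<lambda>x. - f x) = lp_norm p f"
  by (simp add: lp_norm_def)

lemma Lp_add:
  assumes p: "0 < p" and f: "f \<in> Lp p" and h: "h \<in> Lp p"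
  shows "(\<lambda>x. f x + h x) \<in> Lp p"
proof -
  note [measurable] = Lp_measurable[OF f] Lp_measurable[OF h]
  have bd: "cmod (f x + h x) powr p \<le> 2 powr p * (cmod (f x) powr p + cmod (h x) powr p)" for x
  proof -
    have "cmod (f x + h x) powr p \<le> (2 * max (cmod (f x)) (cmod (h x))) powr p"
      using p norm_triangle_ineq[of "f x" "h x"] by (intro powr_mono2) auto
    also have "\<dots> = 2 powr p * max (cmod (f x)) (cmod (h x)) powr p"
      by (simp add: powr_mult)
    also have "\<dots> \<le> 2 powr p * (cmod (f x) powr p + cmod (h x) powr p)"
      by (intro mult_left_mono) (auto simp: max_def)
    finally show ?thesis .
  qed
  have "integrable lebesgue (\<lambda>x. cmod (f x + h x) powr p)"
    by (rule Bochner_Integration.integrable_bound[where f = "\<lambda>x. 2 powr p * (cmod (f x) powr p + cmod (h x) powr p)"])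
       (use bd Lp_integrable[OF f] Lp_integrable[OF h] in \<open>auto intro!: AE_I2\<close>)
  then show ?thesis by (simp add: Lp_def)
qed

lemma Lp_diff:
  assumes "0 < p" "f \<in> Lp p" "h \<in> Lp p"
  shows "(\<lambda>x. f x - h x) \<in> Lp p"
  using Lp_add[OF assms(1,2) Lp_cmult[OF assms(3), of "-1"]] by simp

lemma Lp_sum:
  assumes p: "0 < p" and "\<And>i. i \<in> I \<Longrightarrow> f i \<in> Lp p"
  shows "(\<lambda>x. \<Sum>i\<in>I. f i x) \<in> Lp p"
  using assms(2) by (induction I rule: infinite_finite_induct) (auto intro: Lp_zero Lp_add[OF p])

text \<open>Strict bounds \<open>A\<close>, \<open>B\<close> in place of the norms avoid dividing by a vanishing norm.\<close>

lemma lp_norm_triangle: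
  assumes p: "1 \<le> p" and f: "f \<in> Lp p" and h: "h \<in> Lp p"
  shows "lp_norm p (\<lambda>x. f x + h x) \<le> lp_norm p f + lp_norm p h"
proof -
  have p0: "0 < p" using p by simp
  have main: "lp_norm p (\<lambda>x. f x + h x) \<le> A + B"
    if A: "lp_norm p f < A" and B: "lp_norm p h < B" for A B
  proof (rule lp_norm_leI[OF p0])
    have A0: "0 < A" and B0: "0 < B"
      using A B lp_norm_nonneg[of p f] lp_norm_nonneg[of p h] by linarith+
    \<comment> \<open>Minkowski by convexity: f + h = (A + B) (u f/A + v h/B) with u + v = 1, and
      the p-th powers of |f|/A and |h|/B have integral at most 1.\<close>
    define u where "u = A / (A + B)"
    define v where "v = B / (A + B)"
    have uv: "0 < u" "0 < v" "u + v = 1"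
      using A0 B0 by (auto simp: u_def v_def add_divide_distrib[symmetric])
    define K where "K = (A + B) powr p"
    have K: "0 < K" using A0 B0 by (simp add: K_def)
    show "0 \<le> A + B" using A0 B0 by simp
    have pt: "cmod (f x + h x) powr p
        \<le> K * (u * (cmod (f x) powr p / A powr p) + v * (cmod (h x) powr p / B powr p))" for x
    proof -
      have "cmod (f x + h x) \<le> (A + B) * (u * (cmod (f x) / A) + v * (cmod (h x) / B))"
      proof -
        have "(A + B) * (u * (cmod (f x) / A)) = cmod (f x)" "(A + B) * (v * (cmod (h x) / B)) = cmod (h x)"
          using A0 B0 by (simp_all add: u_def v_def)
        then show ?thesis
          using norm_triangle_ineq[of "f x" "h x"] by (simp only: distrib_left)
      qed
      then have "cmod (f x + h x) powr p
          \<le> ((A + B) * (u * (cmod (f x) / A) + v * (cmod (h x) / B))) powr p"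
        using p by (intro powr_mono2) auto
      also have "\<dots> = K * (u * (cmod (f x) / A) + v * (cmod (h x) / B)) powr p"
        using A0 B0 uv by (simp add: powr_mult K_def)
      also have "\<dots> \<le> K * (u * (cmod (f x) / A) powr p + v * (cmod (h x) / B) powr p)"
        using A0 B0 uv p K by (intro mult_left_mono powr_convex_comb) auto
      finally show ?thesis using A0 B0 by (simp add: powr_divide)
    qed
    have "(\<integral>x. cmod (f x + h x) powr p \<partial>lebesgue)
        \<le> (\<integral>x. K * (u * (cmod (f x) powr p / A powr p) + v * (cmod (h x) powr p / B powr p)) \<partial>lebesgue)"
      by (intro integral_mono pt)
         (use Lp_integrable[OF Lp_add[OF p0 f h]] Lp_integrable[OF f] Lp_integrable[OF h] in auto)
    also have "\<dots> = K * (u * ((\<integral>x. cmod (f x) powr p \<partial>lebesgue) / A powr p)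
        + v * ((\<integral>x. cmod (h x) powr p \<partial>lebesgue) / B powr p))"
      using Lp_integrable[OF f] Lp_integrable[OF h] by simp
    also have "\<dots> \<le> K * (u * 1 + v * 1)"
      using integral_powr_le[OF p0 less_imp_le[OF A]] integral_powr_le[OF p0 less_imp_le[OF B]]
        A0 B0 uv K by (intro mult_left_mono add_mono) auto
    finally show "(\<integral>x. cmod (f x + h x) powr p \<partial>lebesgue) \<le> (A + B) powr p"
      using uv by (simp add: K_def)
  qed
  show ?thesis
  proof (rule field_le_epsilon)
    fix e :: real assume "0 < e"
    then show "lp_norm p (\<lambda>x. f x + h x) \<le> lp_norm p f + lp_norm p h + e"
      using main[of "lp_norm p f + e/2" "lp_norm p h + e/2"] by simp
  qed
qed

lemma lp_norm_triangle_diff: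
  assumes "1 \<le> p" "f \<in> Lp p" "h \<in> Lp p"
  shows "lp_norm p (\<lambda>x. f x - h x) \<le> lp_norm p f + lp_norm p h"
  using lp_norm_triangle[OF assms(1,2) Lp_cmult[OF assms(3), of "-1"]] by (simp add: lp_norm_minus)

lemma lp_norm_sum_le:
  assumes p: "1 \<le> p" and "\<And>i. i \<in> I \<Longrightarrow> f i \<in> Lp p"
  shows "lp_norm p (\<lambda>x. \<Sum>i\<in>I. f i x) \<le> (\<Sum>i\<in>I. lp_norm p (f i))"
  using assms(2)
proof (induction I rule: infinite_finite_induct)
  case (insert i I)
  have "lp_norm p (\<lambda>x. f i x + (\<Sum>i\<in>I. f i x)) \<le> lp_norm p (f i) + lp_norm p (\<lambda>x. \<Sum>i\<in>I. f i x)"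
    using p insert.prems by (intro lp_norm_triangle Lp_sum) auto
  then show ?case using insert by (simp add: order.trans)
qed (use p in \<open>auto simp: lp_norm_zero\<close>)

text \<open>Young's inequality for |f|/A and |h|/B integrates to A B (1/p + 1/q) = A B once A and B
  exceed the norms; letting them decrease to the norms avoids a separate case of vanishing norm. The
  choice A = B = 1 already yields integrability.\<close>

lemma Lp_Holder:
  assumes pq: "1 < p" "1 < q" "1 / p + 1 / q = 1" and f: "f \<in> Lp p" and h: "h \<in> Lp q"
  shows "integrable lebesgue (\<lambda>x. f x * h x)"
    and "cmod (\<integral>x. f x * h x \<partial>lebesgue) \<le> lp_norm p f * lp_norm q h"
proof -
  note [measurable] = Lp_measurable[OF f] Lp_measurable[OF h]
  have pt: "cmod (f x * h x) \<le> A * B * (cmod (f x) powr p / A powr p / p + cmod (h x) powr q / B powr q / q)"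
    if "0 < A" "0 < B" for A B x
  proof -
    have "(cmod (f x) / A) * (cmod (h x) / B) \<le> (cmod (f x) / A) powr p / p + (cmod (h x) / B) powr q / q"
      using that pq by (intro Youngs_inequality) auto
    then have "A * B * ((cmod (f x) / A) * (cmod (h x) / B))
        \<le> A * B * ((cmod (f x) / A) powr p / p + (cmod (h x) / B) powr q / q)"
      using that by (intro mult_left_mono) auto
    then show ?thesis using that by (simp add: powr_divide norm_mult)
  qed
  show int: "integrable lebesgue (\<lambda>x. f x * h x)"
    by (rule Bochner_Integration.integrable_bound[where f = "\<lambda>x. 1 * 1 * (cmod (f x) powr p / 1 powr p / p + cmod (h x) powr q / 1 powr q / q)"])
       (use pt[of 1 1] Lp_integrable[OF f] Lp_integrable[OF h] pq in \<open>auto intro!: AE_I2 simp: abs_of_nonneg\<close>)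
  have main: "cmod (\<integral>x. f x * h x \<partial>lebesgue) \<le> A * B"
    if A: "lp_norm p f < A" and B: "lp_norm q h < B" for A B
  proof -
    have A0: "0 < A" and B0: "0 < B"
      using A B lp_norm_nonneg[of p f] lp_norm_nonneg[of q h] by linarith+
    have "cmod (\<integral>x. f x * h x \<partial>lebesgue) \<le> (\<integral>x. cmod (f x * h x) \<partial>lebesgue)"
      by simp
    also have "\<dots> \<le> (\<integral>x. A * B * (cmod (f x) powr p / A powr p / p + cmod (h x) powr q / B powr q / q) \<partial>lebesgue)"
      using int Lp_integrable[OF f] Lp_integrable[OF h] pt[OF A0 B0] by (intro integral_mono) auto
    also have "\<dots> = A * B * ((\<integral>x. cmod (f x) powr p \<partial>lebesgue) / A powr p / p
        + (\<integral>x. cmod (h x) powr q \<partial>lebesgue) / B powr q / q)"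
      using Lp_integrable[OF f] Lp_integrable[OF h] by simp
    also have "\<dots> \<le> A * B * (1 / p + 1 / q)"
      using integral_powr_le[of p f A] integral_powr_le[of q h B] A B
        A0 B0 pq by (intro mult_left_mono add_mono divide_right_mono) auto
    finally show ?thesis using pq by simp
  qed
  show "cmod (\<integral>x. f x * h x \<partial>lebesgue) \<le> lp_norm p f * lp_norm q h"
  proof (rule tendsto_lowerbound)
    show "((\<lambda>e. (lp_norm p f + e) * (lp_norm q h + e)) \<longlongrightarrow> lp_norm p f * lp_norm q h) (at_right 0)"
      by (auto intro!: tendsto_eq_intros)
    show "\<forall>\<^sub>F e in at_right 0. cmod (\<integral>x. f x * h x \<partial>lebesgue) \<le> (lp_norm p f + e) * (lp_norm q h + e)"
      by (rule eventually_mono[OF eventually_at_right_less[of 0]]) (auto intro: main)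
  qed auto
qed

lemma Lp_nn_integral:
  assumes "0 < p" "f \<in> Lp p"
  shows "(\<integral>\<^sup>+x. ennreal (cmod (f x) powr p) \<partial>lebesgue) = ennreal (lp_norm p f powr p)"
  using assms by (simp add: nn_integral_eq_integral Lp_integrable lp_norm_powr)

text \<open>Limits produced by Fatou's lemma are estimated before they are known to be integrable,
  so membership and norm bound are both read off the nonnegative integral.\<close>

lemma Lp_nn_integralI:
  assumes p: "0 < p" and "0 \<le> C" and [measurable]: "f \<in> borel_measurable lebesgue"
    and le: "(\<integral>\<^sup>+x. ennreal (cmod (f x) powr p) \<partial>lebesgue) \<le> ennreal (C powr p)"
  shows "f \<in> Lp p" "lp_norm p f \<le> C"
proof -
  have fin: "(\<integral>\<^sup>+x. ennreal (cmod (f x) powr p) \<partial>lebesgue) < \<infinity>"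
    using le by (simp add: order_le_less_trans)
  show f: "f \<in> Lp p"
    unfolding Lp_def using fin by (auto intro!: integrableI_nonneg)
  have "ennreal (lp_norm p f powr p) \<le> ennreal (C powr p)"
    using le by (simp add: Lp_nn_integral[OF p f])
  then show "lp_norm p f \<le> C"
    using p \<open>0 \<le> C\<close> by (intro lp_norm_leI) (auto simp: lp_norm_powr)
qed

text \<open>Riesz-Fischer for absolutely convergent series, with an explicit tail bound, which is
  the form that the gliding hump consumes. Monotone convergence applied to the sums of moduli gives
  convergence almost everywhere.\<close>

lemma Lp_complete:
  fixes f :: "nat \<Rightarrow> real \<Rightarrow> complex"
  assumes p: "1 \<le> p" and f: "\<And>i. f i \<in> Lp p" and r: "\<And>i. lp_norm p (f i) \<le> r i" "summable r"
  shows "\<exists>F\<in>Lp p. \<forall>m. lp_norm p (\<lambda>x. F x - (\<Sum>i<m. f i x)) \<le> (\<Sum>i. r (i + m))"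
proof -
  have p0: "0 < p" using p by simp
  note [measurable] = Lp_measurable[OF f]
  have r0: "0 \<le> r i" for i using r(1)[of i] lp_norm_nonneg[of p "f i"] by linarith
  define G where "G m x = (\<Sum>i<m. cmod (f i x))" for m x
  have [measurable]: "G m \<in> borel_measurable lebesgue" for m
    unfolding G_def by measurable
  have G0: "0 \<le> G m x" for m x by (simp add: G_def sum_nonneg)
  have Gint: "(\<integral>\<^sup>+x. ennreal (G m x powr p) \<partial>lebesgue) \<le> ennreal ((\<Sum>i. r i) powr p)" for m
  proof -
    have a: "(\<lambda>x. of_real (cmod (f i x))) \<in> Lp p" for i
      using f[of i] by (auto simp: Lp_def)
    have b: "lp_norm p (\<lambda>x. of_real (cmod (f i x))) = lp_norm p (f i)" for i
      by (simp add: lp_norm_def)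
    have G_eq: "cmod (\<Sum>i<m. of_real (cmod (f i x))) = G m x" for x
      using G0[of m x] by (simp add: G_def of_real_sum[symmetric] del: of_real_sum)
    have "lp_norm p (\<lambda>x. \<Sum>i<m. of_real (cmod (f i x))) \<le> (\<Sum>i<m. r i)"
      using lp_norm_sum_le[of p "{..<m}" "\<lambda>i x. of_real (cmod (f i x))", OF p a] sum_mono[of "{..<m}" "\<lambda>i. lp_norm p (f i)" r] r(1)
      by (simp add: b)
    also have "\<dots> \<le> (\<Sum>i. r i)"
      using r(2) r0 by (intro sum_le_suminf) auto
    finally have "lp_norm p (\<lambda>x. \<Sum>i<m. of_real (cmod (f i x))) powr p \<le> (\<Sum>i. r i) powr p"
      using p0 by (intro powr_mono2) (auto simp: lp_norm_nonneg)
    moreover have "(\<integral>\<^sup>+x. ennreal (G m x powr p) \<partial>lebesgue)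
        = ennreal (lp_norm p (\<lambda>x. \<Sum>i<m. of_real (cmod (f i x))) powr p)"
      using Lp_nn_integral[OF p0 Lp_sum[of p "{..<m}" "\<lambda>i x. of_real (cmod (f i x))", OF p0 a]] by (simp add: G_eq)
    ultimately show ?thesis by (simp add: ennreal_leI)
  qed
  have "(\<integral>\<^sup>+x. (SUP m. ennreal (G m x powr p)) \<partial>lebesgue) = (SUP m. (\<integral>\<^sup>+x. ennreal (G m x powr p) \<partial>lebesgue))"
  proof (rule nn_integral_monotone_convergence_SUP)
    show "incseq (\<lambda>m x. ennreal (G m x powr p))"
    proof (intro incseq_SucI le_funI ennreal_leI powr_mono2)
      fix m x show "G m x \<le> G (Suc m) x" by (simp add: G_def)
    qed (use p0 G0 in auto)
  qed simp
  also have "\<dots> \<le> ennreal ((\<Sum>i. r i) powr p)"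
    by (intro SUP_least Gint)
  finally have "(\<integral>\<^sup>+x. (SUP m. ennreal (G m x powr p)) \<partial>lebesgue) \<noteq> \<infinity>"
    by (auto simp: top_unique)
  then have "AE x in lebesgue. (SUP m. ennreal (G m x powr p)) \<noteq> \<infinity>"
    by (intro nn_integral_PInf_AE) auto
  then have AE_summable: "AE x in lebesgue. summable (\<lambda>i. f i x)"
  proof (rule eventually_mono)
    fix x assume fin: "(SUP m. ennreal (G m x powr p)) \<noteq> \<infinity>"
    then obtain C where C: "0 \<le> C" "(SUP m. ennreal (G m x powr p)) = ennreal C"
      by (cases "(SUP m. ennreal (G m x powr p))") auto
    have "G m x \<le> C powr (1 / p)" for m
    proof -
      have "ennreal (G m x powr p) \<le> ennreal C"
        unfolding C(2)[symmetric] by (rule SUP_upper) simp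
      then have "(G m x powr p) powr (1 / p) \<le> C powr (1 / p)"
        using C p0 by (intro powr_mono2) auto
      then show ?thesis using p0 G0[of m x] by (simp add: powr_powr)
    qed
    then have "summable (\<lambda>i. cmod (f i x))"
      by (intro summableI_nonneg_bounded[where x = "C powr (1 / p)"]) (auto simp: G_def)
    then show "summable (\<lambda>i. f i x)" by (rule summable_norm_cancel)
  qed
  \<comment> \<open>At points of divergence \<open>suminf\<close> has an arbitrary value, but they
    form a null set.\<close>
  define F where "F x = (\<Sum>i. f i x)" for x
  have [measurable]: "F \<in> borel_measurable lebesgue"
    unfolding F_def by measurable
  have tail: "(\<integral>\<^sup>+x. ennreal (cmod (F x - (\<Sum>i<m. f i x)) powr p) \<partial>lebesgue) \<le> ennreal ((\<Sum>i. r (i + m)) powr p)" for m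
  proof -
    \<comment> \<open>The tail of the series is only an almost everywhere limit of the finite sums
      \<open>D M\<close>; Fatou's lemma passes their common norm bound on to it.\<close>
    define D where "D M x = (\<Sum>i<M. f (i + m) x)" for M x
    have D[measurable]: "D M \<in> borel_measurable lebesgue" for M
      unfolding D_def by measurable
    have "(\<integral>\<^sup>+x. ennreal (cmod (F x - (\<Sum>i<m. f i x)) powr p) \<partial>lebesgue)
        = (\<integral>\<^sup>+x. liminf (\<lambda>M. ennreal (cmod (D M x) powr p)) \<partial>lebesgue)"
    proof (rule nn_integral_cong_AE, rule eventually_mono[OF AE_summable])
      fix x assume s: "summable (\<lambda>i. f i x)"
      have "(\<lambda>M. D M x) \<longlonglongrightarrow> (\<Sum>i. f (i + m) x)"
        unfolding D_def using s summable_iff_shift[of "\<lambda>i. f i x" m] by (intro summable_LIMSEQ) simp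
      then have "(\<lambda>M. D M x) \<longlonglongrightarrow> F x - (\<Sum>i<m. f i x)"
        using suminf_minus_initial_segment[OF s, of m] by (simp add: F_def)
      then have "(\<lambda>M. ennreal (cmod (D M x) powr p)) \<longlonglongrightarrow> ennreal (cmod (F x - (\<Sum>i<m. f i x)) powr p)"
        using p0 by (intro tendsto_intros) auto
      then show "ennreal (cmod (F x - (\<Sum>i<m. f i x)) powr p) = liminf (\<lambda>M. ennreal (cmod (D M x) powr p))"
        by (rule lim_imp_Liminf[OF trivial_limit_sequentially, symmetric])
    qed
    also have "\<dots> \<le> liminf (\<lambda>M. (\<integral>\<^sup>+x. ennreal (cmod (D M x) powr p) \<partial>lebesgue))"
      by (rule nn_integral_liminf) simp
    also have "\<dots> \<le> liminf (\<lambda>M. ennreal ((\<Sum>i. r (i + m)) powr p))"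
    proof (rule Liminf_mono, rule always_eventually, rule allI)
      fix M
      have DL: "D M \<in> Lp p" unfolding D_def by (intro Lp_sum p0 f)
      have "lp_norm p (D M) \<le> (\<Sum>i<M. lp_norm p (f (i + m)))"
        unfolding D_def by (intro lp_norm_sum_le p f)
      also have "\<dots> \<le> (\<Sum>i<M. r (i + m))" by (intro sum_mono r)
      also have "\<dots> \<le> (\<Sum>i. r (i + m))"
        using r r0 by (intro sum_le_suminf) (auto simp: summable_iff_shift)
      finally show "(\<integral>\<^sup>+x. ennreal (cmod (D M x) powr p) \<partial>lebesgue) \<le> ennreal ((\<Sum>i. r (i + m)) powr p)"
        unfolding Lp_nn_integral[OF p0 DL] using p0 lp_norm_nonneg by (intro ennreal_leI powr_mono2) auto
    qed
    finally show ?thesis by (simp add: Liminf_const)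
  qed
  have tail0: "0 \<le> (\<Sum>i. r (i + m))" for m
    using r r0 by (intro suminf_nonneg) (auto simp: summable_iff_shift)
  have "F \<in> Lp p"
    using Lp_nn_integralI(1)[OF p0 tail0[of 0], of F] tail[of 0] by simp
  moreover have "lp_norm p (\<lambda>x. F x - (\<Sum>i<m. f i x)) \<le> (\<Sum>i. r (i + m))" for m
    by (rule Lp_nn_integralI(2)[OF p0 tail0 _ tail]) simp
  ultimately show ?thesis by blast
qed

section \<open>Uniform boundedness\<close>

text \<open>Sokal's version of the gliding hump: at step \<open>m\<close> one adds or subtracts a near-extremal vector of
  norm \<open>3\<^sup>-\<^sup>m\<close> for a seminorm of size \<open>4\<^sup>m\<close>.\<close>

lemma Lp_uniform_boundedness:
  fixes S :: "'i \<Rightarrow> (real \<Rightarrow> complex) \<Rightarrow> real"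
  assumes p: "1 \<le> p"
    and nonneg: "\<And>i f. i \<in> I \<Longrightarrow> f \<in> Lp p \<Longrightarrow> 0 \<le> S i f"
    and bounded: "\<And>i. i \<in> I \<Longrightarrow> \<exists>C. \<forall>f\<in>Lp p. S i f \<le> C * lp_norm p f"
    and triangle: "\<And>i f h. i \<in> I \<Longrightarrow> f \<in> Lp p \<Longrightarrow> h \<in> Lp p \<Longrightarrow> S i (\<lambda>x. f x + h x) \<le> S i f + S i h"
    and homogeneous: "\<And>i f a. i \<in> I \<Longrightarrow> f \<in> Lp p \<Longrightarrow> S i (\<lambda>x. a * f x) = cmod a * S i f"
    and pointwise: "\<And>f. f \<in> Lp p \<Longrightarrow> \<exists>C. \<forall>i\<in>I. S i f \<le> C"
  shows "\<exists>K\<ge>0. \<forall>i\<in>I. \<forall>f\<in>Lp p. S i f \<le> K * lp_norm p f"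
proof (rule ccontr)
  assume contra: "\<not> ?thesis"
  have p0: "0 < p" using p by simp
  define B where "B i = {C. 0 \<le> C \<and> (\<forall>f\<in>Lp p. S i f \<le> C * lp_norm p f)}" for i
  define opn where "opn i = Inf (B i)" for i
  have B_bdd: "bdd_below (B i)" for i
    by (rule bdd_belowI[of _ 0]) (simp add: B_def)
  have B_ne: "B i \<noteq> {}" if "i \<in> I" for i
  proof -
    from bounded[OF that] obtain C where C: "\<forall>f\<in>Lp p. S i f \<le> C * lp_norm p f" by blast
    have "S i f \<le> max C 0 * lp_norm p f" if "f \<in> Lp p" for f
      using C that mult_right_mono[of C "max C 0" "lp_norm p f"] lp_norm_nonneg[of p f] by force
    then have "max C 0 \<in> B i" by (simp add: B_def)
    then show ?thesis by blast
  qed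
  have opn0: "0 \<le> opn i" if "i \<in> I" for i
    unfolding opn_def using B_ne[OF that] by (intro cInf_greatest) (auto simp: B_def)
  have opn: "S i f \<le> opn i * lp_norm p f" if "i \<in> I" "f \<in> Lp p" for i f
  proof (cases "lp_norm p f = 0")
    case True
    with B_ne[OF that(1)] that(2) show ?thesis by (auto simp: B_def)
  next
    case False
    then have pos: "0 < lp_norm p f" using lp_norm_nonneg[of p f] by linarith
    have "S i f / lp_norm p f \<le> opn i"
      unfolding opn_def using B_ne[OF that(1)] that(2) pos
      by (intro cInf_greatest) (auto simp: B_def field_simps)
    then show ?thesis using pos by (simp add: field_simps)
  qed
  \<comment> \<open>From 2y = (z + y) - (z - y), one of z + y and z - y has seminorm at least that
    of y. So whatever has been built up in \<open>z\<close> cannot cancel the new hump, provided its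
    sign is chosen well.\<close>
  have hump: "\<exists>y\<in>Lp p. lp_norm p y \<le> r \<and> 9/10 * r * opn i \<le> S i (\<lambda>x. z x + y x)"
    if i: "i \<in> I" and r: "0 < r" and z: "z \<in> Lp p" and "0 < opn i" for i r z
  proof -
    have "9/10 * opn i \<notin> B i"
      using cInf_lower[OF _ B_bdd, of "9/10 * opn i" i] \<open>0 < opn i\<close> by (auto simp: opn_def)
    then obtain y1 where y1: "y1 \<in> Lp p" "9/10 * opn i * lp_norm p y1 < S i y1"
      using \<open>0 < opn i\<close> by (auto simp: B_def not_le)
    have "lp_norm p y1 \<noteq> 0"
      using opn[OF i y1(1)] y1(2) by auto
    then have n1: "0 < lp_norm p y1" using lp_norm_nonneg[of p y1] by linarith
    define a where "a = r / lp_norm p y1"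
    have a: "0 < a" using n1 r by (simp add: a_def)
    define y where "y = (\<lambda>x. complex_of_real a * y1 x)"
    have y: "y \<in> Lp p" unfolding y_def by (rule Lp_cmult[OF y1(1)])
    have ny: "lp_norm p y = r"
    proof -
      have "lp_norm p y = a * lp_norm p y1" using a by (simp only: y_def lp_norm_cmult[OF p0]) simp
      then show ?thesis using n1 by (simp add: a_def)
    qed
    have Sy: "9/10 * r * opn i \<le> S i y"
    proof -
      have "9/10 * r * opn i = a * (9/10 * opn i * lp_norm p y1)" using n1 by (simp add: a_def)
      also have "\<dots> \<le> a * S i y1" using y1(2) a by simp
      finally show ?thesis unfolding y_def using homogeneous[OF i y1(1)] a by simp
    qed
    have zy: "(\<lambda>x. z x + y x) \<in> Lp p" and zy': "(\<lambda>x. (-1) * (z x - y x)) \<in> Lp p"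
      by (intro Lp_add Lp_cmult Lp_diff p0 z y)+
    have "2 * S i y = S i (\<lambda>x. 2 * y x)" using homogeneous[OF i y, of 2] by simp
    also have "(\<lambda>x. 2 * y x) = (\<lambda>x. (z x + y x) + (-1) * (z x - y x))" by auto
    also have "S i \<dots> \<le> S i (\<lambda>x. z x + y x) + S i (\<lambda>x. (-1) * (z x - y x))"
      by (rule triangle[OF i zy zy'])
    also have "S i (\<lambda>x. (-1) * (z x - y x)) = S i (\<lambda>x. z x - y x)"
      using homogeneous[OF i Lp_diff[OF p0 z y], of "-1"] by simp
    finally have "S i y \<le> S i (\<lambda>x. z x + y x) \<or> S i y \<le> S i (\<lambda>x. z x - y x)" by linarith
    then show ?thesis
    proof
      assume "S i y \<le> S i (\<lambda>x. z x + y x)"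
      then show ?thesis using y ny Sy by (intro bexI[of _ y]) auto
    next
      assume "S i y \<le> S i (\<lambda>x. z x - y x)"
      then show ?thesis using Lp_cmult[OF y, of "-1"] ny Sy
        by (intro bexI[of _ "\<lambda>x. - y x"]) (auto simp: lp_norm_minus)
    qed
  qed
  have "\<exists>i\<in>I. 4 ^ m < opn i" for m :: nat
  proof (rule ccontr)
    assume "\<not> ?thesis"
    then have "S i f \<le> 4 ^ m * lp_norm p f" if "i \<in> I" "f \<in> Lp p" for i f
      using opn[OF that] mult_right_mono[of "opn i" "4 ^ m" "lp_norm p f"] that
      by (force simp: not_less lp_norm_nonneg)
    with contra show False by (metis zero_le_power zero_le_numeral)
  qed
  then obtain j where j: "\<And>m :: nat. j m \<in> I" "\<And>m. 4 ^ m < opn (j m)" by metis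
  have j0: "0 < opn (j m)" for m using j(2)[of m] by (smt (verit) zero_less_power)
  define Y where "Y m z = (SOME y. y \<in> Lp p \<and> lp_norm p y \<le> (1/3)^m
      \<and> 9/10 * (1/3)^m * opn (j m) \<le> S (j m) (\<lambda>x. z x + y x))" for m z
  have Y: "Y m z \<in> Lp p" "lp_norm p (Y m z) \<le> (1/3)^m"
      "9/10 * (1/3)^m * opn (j m) \<le> S (j m) (\<lambda>x. z x + Y m z x)" if "z \<in> Lp p" for m z
    using someI_ex[OF hump[OF j(1) _ that j0, of "(1/3)^m" m, unfolded Bex_def]] by (simp_all add: Y_def)
  define X where "X = rec_nat (\<lambda>x. 0 :: complex) (\<lambda>m z x. z x + Y m z x)"
  have X_0: "X 0 = (\<lambda>x. 0)" and X_Suc: "X (Suc m) = (\<lambda>x. X m x + Y m (X m) x)" for m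
    by (simp_all add: X_def)
  have XL: "X m \<in> Lp p" for m
    by (induction m) (auto simp: X_0 X_Suc Lp_zero intro!: Lp_add p0 Y)
  have X_sum: "X m x = (\<Sum>i<m. Y i (X i) x)" for m x
    by (induction m) (auto simp: X_0 X_Suc)
  have "summable (\<lambda>i. (1/3 :: real) ^ i)" by simp
  from Lp_complete[of p "\<lambda>i. Y i (X i)" "\<lambda>i. (1/3) ^ i", OF p Y(1)[OF XL] Y(2)[OF XL] this] obtain F
    where F: "F \<in> Lp p" "\<And>m. lp_norm p (\<lambda>x. F x - X m x) \<le> (\<Sum>i. (1/3) ^ (i + m))"
    unfolding X_sum[symmetric] by blast
  obtain C where C: "\<And>i. i \<in> I \<Longrightarrow> S i F \<le> C" using pointwise[OF F(1)] by blast
  \<comment> \<open>The terms after step \<open>m\<close> have total norm at most the sum of 3^-i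
    over i > m, which is half of 3^-m. They can destroy half of the hump, and 9/10 - 1/2 = 2/5
    remains; any factor strictly between 1/2 and 1 would do in place of 9/10.\<close>
  have "2/5 * (4/3) ^ m \<le> C" for m :: nat
  proof -
    let ?D = "\<lambda>x. F x - X (Suc m) x"
    have "(\<Sum>i. (1/3 :: real) ^ (i + Suc m)) = 1/2 * (1/3) ^ m"
      using suminf_mult2[of "\<lambda>i. (1/3 :: real) ^ i" "(1/3) ^ Suc m"] suminf_geometric[of "1/3 :: real"]
      by (simp add: power_add)
    then have D: "lp_norm p ?D \<le> 1/2 * (1/3) ^ m" using F(2)[of "Suc m"] by simp
    have DL: "?D \<in> Lp p" by (intro Lp_diff p0 F(1) XL)
    have "9/10 * (1/3)^m * opn (j m) \<le> S (j m) (X (Suc m))"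
      unfolding X_Suc by (rule Y(3)[OF XL])
    also have "X (Suc m) = (\<lambda>x. F x + (-1) * ?D x)" by auto
    also have "S (j m) \<dots> \<le> S (j m) F + S (j m) (\<lambda>x. (-1) * ?D x)"
      by (rule triangle[OF j(1) F(1) Lp_cmult[OF DL]])
    also have "S (j m) (\<lambda>x. (-1) * ?D x) = S (j m) ?D"
      using homogeneous[OF j(1) DL, of m "-1"] by simp
    also have "S (j m) ?D \<le> opn (j m) * (1/2 * (1/3) ^ m)"
      using opn[OF j(1) DL, of m] mult_left_mono[OF D less_imp_le[OF j0[of m]]] by linarith
    also have "S (j m) F \<le> C" using C j(1) by simp
    finally have "2/5 * ((1/3)^m * opn (j m)) \<le> C" by (simp add: algebra_simps)
    moreover have "(1/3) ^ m * 4 ^ m \<le> (1/3) ^ m * opn (j m)"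
      using j(2)[of m] by (intro mult_left_mono) auto
    ultimately show ?thesis by (simp add: power_mult_distrib[symmetric])
  qed
  note le_C = this
  obtain m :: nat where "5/2 * C < (4/3) ^ m"
    using real_arch_pow[of "4/3" "5/2 * C"] by auto
  then show False using le_C[of m] by simp
qed

section \<open>Random signs\<close>

text \<open>Derandomised moments: the left-hand side bounds the expectation of the right-hand side over the
  signs not yet chosen, and averaging over one more sign does not decrease it.\<close>

lemma signs_moment_potential:
  fixes a :: "'k \<Rightarrow> 'n \<Rightarrow> complex" and \<alpha> \<beta> :: "'n \<Rightarrow> real"
  assumes "finite A" and \<beta>: "\<And>n. n \<in> F \<Longrightarrow> 0 \<le> \<beta> n"
  shows "\<exists>e :: 'k \<Rightarrow> real. (\<forall>k. \<bar>e k\<bar> = (1 :: real)) \<and>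
    (\<Sum>n\<in>F. \<alpha> n * (cmod (X n)^2 + (\<Sum>k\<in>A. cmod (a k n)^2))
        - \<beta> n * (cmod (X n)^4 + 6 * cmod (X n)^2 * (\<Sum>k\<in>A. cmod (a k n)^2) + 3 * (\<Sum>k\<in>A. cmod (a k n)^2)^2))
    \<le> (\<Sum>n\<in>F. \<alpha> n * cmod (X n + (\<Sum>k\<in>A. e k * a k n))^2 - \<beta> n * cmod (X n + (\<Sum>k\<in>A. e k * a k n))^4)"
  using assms(1)
proof (induction A arbitrary: X rule: finite_induct)
  case empty
  show ?case by (rule exI[of _ "\<lambda>_. 1"]) simp
next
  case (insert k A)
  define R where "R n = (\<Sum>k\<in>A. cmod (a k n)^2)" for n
  \<comment> \<open>The quartic is the fourth moment of z plus a centred real Gaussian of variance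
    R, for real z; it dominates the fourth moment of the signed sum also for complex data. The
    second moment is exact.\<close>
  define P where "P n z = \<alpha> n * (cmod z^2 + R n) - \<beta> n * (cmod z^4 + 6 * cmod z^2 * R n + 3 * R n^2)" for n z
  define Q where "Q n = \<alpha> n * (cmod (X n)^2 + (cmod (a k n)^2 + R n))
        - \<beta> n * (cmod (X n)^4 + 6 * cmod (X n)^2 * (cmod (a k n)^2 + R n) + 3 * (cmod (a k n)^2 + R n)^2)" for n
  \<comment> \<open>The cross term \<open>t\<close> cancels in the second moments. In the fourth
    moments only its square survives, and |Re(X cnj a)| <= |X| |a| bounds it by 4 x b, leaving the
    surplus 4 b^2.\<close>
  have "2 * Q n \<le> P n (X n + a k n) + P n (X n - a k n)" if "n \<in> F" for n
  proof -
    define x where "x = cmod (X n)^2"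
    define b where "b = cmod (a k n)^2"
    define t where "t = 2 * Re (X n * cnj (a k n))"
    have b0: "0 \<le> b" and R0: "0 \<le> R n" by (simp_all add: b_def R_def sum_nonneg)
    have plus: "cmod (X n + a k n)^2 = x + b + t" and minus: "cmod (X n - a k n)^2 = x + b - t"
      unfolding x_def b_def t_def cmod_power2 by (simp_all add: power2_eq_square algebra_simps)
    have "t^2 = 4 * (Re (X n * cnj (a k n)))^2" by (simp only: t_def power_mult_distrib) simp
    also have "\<dots> \<le> 4 * cmod (X n * cnj (a k n))^2"
      by (intro mult_left_mono) (simp_all add: cmod_power2)
    also have "\<dots> = 4 * (x * b)" by (simp add: x_def b_def norm_mult power_mult_distrib)
    finally have t: "t^2 \<le> 4 * (x * b)" .
    have four: "cmod z^4 = (cmod z^2)^2" for z by simp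
    have "(x + b + t)^2 + (x + b - t)^2 + 12 * (x + b) * R n + 6 * R n^2
        \<le> 2 * (x^2 + 6 * x * (b + R n) + 3 * (b + R n)^2)"
    proof -
      have "2 * (x^2 + 6 * x * (b + R n) + 3 * (b + R n)^2)
          - ((x + b + t)^2 + (x + b - t)^2 + 12 * (x + b) * R n + 6 * R n^2)
        = 2 * (4 * (x * b) - t^2) + 4 * (b * b)"
        by (simp add: power2_eq_square algebra_simps)
      also have "0 \<le> \<dots>"
        using t mult_nonneg_nonneg[OF b0 b0] b0 by (intro add_nonneg_nonneg mult_nonneg_nonneg) auto
      finally show ?thesis by (simp only: diff_ge_0_iff_ge)
    qed
    then have "\<beta> n * ((x + b + t)^2 + (x + b - t)^2 + 12 * (x + b) * R n + 6 * R n^2)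
        \<le> \<beta> n * (2 * (x^2 + 6 * x * (b + R n) + 3 * (b + R n)^2))"
      by (intro mult_left_mono \<beta> that)
    then show ?thesis
      unfolding P_def Q_def four plus minus x_def[symmetric] b_def[symmetric]
      by (simp add: algebra_simps)
  qed
  then have "(\<Sum>n\<in>F. 2 * Q n) \<le> (\<Sum>n\<in>F. P n (X n + a k n) + P n (X n - a k n))"
    by (rule sum_mono)
  then have "2 * (\<Sum>n\<in>F. Q n) \<le> (\<Sum>n\<in>F. P n (X n + a k n)) + (\<Sum>n\<in>F. P n (X n - a k n))"
    by (simp only: sum.distrib sum_distrib_left)
  then have "(\<Sum>n\<in>F. Q n) \<le> (\<Sum>n\<in>F. P n (X n + a k n)) \<or> (\<Sum>n\<in>F. Q n) \<le> (\<Sum>n\<in>F. P n (X n - a k n))"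
    by linarith
  then obtain s :: real where s: "\<bar>s\<bar> = 1" "(\<Sum>n\<in>F. Q n) \<le> (\<Sum>n\<in>F. P n (X n + s * a k n))"
  proof
    assume "(\<Sum>n\<in>F. Q n) \<le> (\<Sum>n\<in>F. P n (X n + a k n))"
    then show ?thesis by (intro that[of 1]) auto
  next
    assume "(\<Sum>n\<in>F. Q n) \<le> (\<Sum>n\<in>F. P n (X n - a k n))"
    then show ?thesis by (intro that[of "-1"]) auto
  qed
  from insert.IH[of "\<lambda>n. X n + s * a k n"] obtain e :: "'k \<Rightarrow> real" where e: "\<forall>k. \<bar>e k\<bar> = (1 :: real)"
    "(\<Sum>n\<in>F. P n (X n + s * a k n)) \<le> (\<Sum>n\<in>F. \<alpha> n * cmod (X n + s * a k n + (\<Sum>k\<in>A. e k * a k n))^2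
       - \<beta> n * cmod (X n + s * a k n + (\<Sum>k\<in>A. e k * a k n))^4)"
    unfolding P_def R_def by blast
  have eq: "X n + s * a k n + (\<Sum>k\<in>A. e k * a k n) = X n + (\<Sum>i\<in>insert k A. (e(k := s)) i * a i n)" for n
  proof -
    have "(\<Sum>i\<in>A. (e(k := s)) i * a i n) = (\<Sum>i\<in>A. e i * a i n)"
      using insert.hyps by (intro sum.cong) auto
    then show ?thesis using insert.hyps by (simp add: add.assoc)
  qed
  have R': "(\<Sum>k\<in>insert k A. cmod (a k n)^2) = cmod (a k n)^2 + R n" for n
    using insert.hyps by (simp add: R_def)
  show ?case
    using e s(1) order.trans[OF s(2) e(2)] unfolding eq R' Q_def
    by (intro exI[of _ "e(k := s)"] conjI) auto
qed

text \<open>The lower L^1 Khintchine inequality, with a single choice of signs that serves the whole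
  weighted sum over \<open>F\<close>. It follows from the pointwise bound y >= y^2/\<sigma> - (4/27)
  y^4/\<sigma>^3, whose right side has expectation at least \<sigma> - (4/9) \<sigma> = (5/9)
  \<sigma>, more than half of \<sigma>.\<close>

lemma signs_Khintchine:
  fixes a :: "'k \<Rightarrow> 'n \<Rightarrow> complex"
  assumes A: "finite A" and w: "\<And>n. n \<in> F \<Longrightarrow> 0 \<le> w n"
  shows "\<exists>e :: 'k \<Rightarrow> real. (\<forall>k. \<bar>e k\<bar> = (1 :: real)) \<and>
    (\<Sum>n\<in>F. w n * sqrt (\<Sum>k\<in>A. cmod (a k n)^2)) \<le> 2 * (\<Sum>n\<in>F. w n * cmod (\<Sum>k\<in>A. e k * a k n))"
proof -
  define \<sigma> where "\<sigma> n = sqrt (\<Sum>k\<in>A. cmod (a k n)^2)" for n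
  have \<sigma>0: "0 \<le> \<sigma> n" and \<sigma>2: "(\<Sum>k\<in>A. cmod (a k n)^2) = \<sigma> n ^ 2" for n
    by (simp_all add: \<sigma>_def sum_nonneg)
  define \<alpha> where "\<alpha> n = w n / \<sigma> n" for n
  \<comment> \<open>The number 4/27 makes u - u^2 + (4/27) u^4 touch zero at u = 3/2 without
    becoming negative on u >= 0: it factors as u (2u - 3)^2 (u + 3) / 27. If
    \<open>\<sigma> n = 0\<close>, division by zero gives \<alpha> = \<beta> = 0 and both estimates
    are trivial.\<close>
  define \<beta> where "\<beta> n = 4/27 * w n / \<sigma> n ^ 3" for n
  have \<beta>0: "0 \<le> \<beta> n" if "n \<in> F" for n using \<sigma>0 w[OF that] by (simp add: \<beta>_def)
  obtain e :: "'k \<Rightarrow> real" where e: "\<forall>k. \<bar>e k\<bar> = (1 :: real)" and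
    le: "(\<Sum>n\<in>F. \<alpha> n * \<sigma> n ^ 2 - \<beta> n * (3 * (\<sigma> n ^ 2)^2))
      \<le> (\<Sum>n\<in>F. \<alpha> n * cmod (\<Sum>k\<in>A. e k * a k n)^2 - \<beta> n * cmod (\<Sum>k\<in>A. e k * a k n)^4)"
    using signs_moment_potential[where F = F and \<beta> = \<beta> and X = "\<lambda>_. 0" and a = a and \<alpha> = \<alpha>, OF A \<beta>0] unfolding \<sigma>2 by auto
  have "(\<Sum>n\<in>F. w n * \<sigma> n) \<le> (\<Sum>n\<in>F. 2 * (\<alpha> n * \<sigma> n ^ 2 - \<beta> n * (3 * (\<sigma> n ^ 2)^2)))"
  proof (rule sum_mono)
    fix n assume n: "n \<in> F"
    show "w n * \<sigma> n \<le> 2 * (\<alpha> n * \<sigma> n ^ 2 - \<beta> n * (3 * (\<sigma> n ^ 2)^2))"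
    proof (cases "\<sigma> n = 0")
      case False
      then have eq: "\<alpha> n * \<sigma> n ^ 2 - \<beta> n * (3 * (\<sigma> n ^ 2)^2) = 5/9 * (w n * \<sigma> n)"
        by (simp add: \<alpha>_def \<beta>_def field_simps eval_nat_numeral)
      have "0 \<le> w n * \<sigma> n" using w[OF n] \<sigma>0[of n] by simp
      then show ?thesis unfolding eq by (simp only:)
    qed simp
  qed
  also have "\<dots> \<le> 2 * (\<Sum>n\<in>F. \<alpha> n * cmod (\<Sum>k\<in>A. e k * a k n)^2 - \<beta> n * cmod (\<Sum>k\<in>A. e k * a k n)^4)"
    unfolding sum_distrib_left[symmetric] using le by (intro mult_left_mono) simp_all
  also have "\<dots> \<le> 2 * (\<Sum>n\<in>F. w n * cmod (\<Sum>k\<in>A. e k * a k n))"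
  proof (intro mult_left_mono sum_mono)
    fix n assume n: "n \<in> F"
    define y where "y = cmod (\<Sum>k\<in>A. e k * a k n)"
    have "\<alpha> n * y^2 - \<beta> n * y^4 \<le> w n * y"
    proof (cases "\<sigma> n = 0")
      case True
      then show ?thesis using w[OF n] by (simp add: \<alpha>_def \<beta>_def y_def)
    next
      case False
      then have s: "0 < \<sigma> n" using \<sigma>0[of n] by simp
      define u where "u = y / \<sigma> n"
      have y: "y = u * \<sigma> n" and u: "0 \<le> u" using s by (simp_all add: u_def y_def)
      have "0 \<le> w n * \<sigma> n * (1/27 * u * (2 * u - 3)^2 * (u + 3))"
        using u s w[OF n] by simp
      also have "\<dots> = w n * \<sigma> n * (u - u^2 + 4/27 * u^4)"
        by (simp add: power2_eq_square power4_eq_xxxx field_simps)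
      also have "\<dots> = w n * y - (\<alpha> n * y^2 - \<beta> n * y^4)"
        using s by (simp add: y \<alpha>_def \<beta>_def field_simps eval_nat_numeral)
      finally show ?thesis by simp
    qed
    then show "\<alpha> n * cmod (\<Sum>k\<in>A. e k * a k n)^2 - \<beta> n * cmod (\<Sum>k\<in>A. e k * a k n)^4
        \<le> w n * cmod (\<Sum>k\<in>A. e k * a k n)" by (simp add: y_def)
  qed simp
  finally show ?thesis using e unfolding \<sigma>_def by blast
qed

section \<open>Amalgam spaces and uniformly discrete sets\<close>

text \<open>An essential supremum bounds |g| only almost everywhere on its cell. For continuous
  \<open>g\<close> the bound describes a closed set, so it holds on the whole open cell and, by
  closure, at the endpoints. The point values \<open>g (- t)\<close> require this.\<close>

lemma wiener_amalgam_majorant: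
  assumes g: "continuous_on UNIV g" and W: "wiener_amalgam g"
  shows "\<exists>M :: int \<Rightarrow> real. (\<forall>k. 0 \<le> M k) \<and> M summable_on UNIV \<and>
    (\<forall>k x. of_int k \<le> x \<and> x \<le> of_int k + 1 \<longrightarrow> cmod (g x) \<le> M k)"
proof -
  define E where "E k = esssup (restrict_space lebesgue {real_of_int k .. real_of_int k + 1})
                         (\<lambda>x. ennreal (cmod (g x)))" for k :: int
  define L where "L = (\<Sum>\<^sub>\<infinity>k. E k)"
  have L: "L < \<infinity>" using W by (simp add: wiener_amalgam_def L_def E_def)
  have sum_E: "sum E A \<le> L" if "finite A" for A
    unfolding L_def using that by (subst nonneg_infsum_complete) (auto intro!: SUP_upper)
  have E_fin: "E k < \<infinity>" for k using sum_E[of "{k}"] L by (auto simp: order_le_less_trans)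
  define M where "M k = enn2real (E k)" for k
  have E_M: "E k = ennreal (M k)" for k using E_fin[of k] by (simp add: M_def)
  have M0: "0 \<le> M k" for k by (simp add: M_def)
  have "sum M A \<le> enn2real L" if "finite A" for A
  proof -
    have "ennreal (sum M A) \<le> ennreal (enn2real L)"
      using sum_E[OF that] L M0 by (simp add: E_M)
    then show ?thesis by (subst (asm) ennreal_le_iff) auto
  qed
  then have "M summable_on UNIV"
    by (intro nonneg_bdd_above_summable_on bdd_aboveI2[where M = "enn2real L"]) (auto simp: M0)
  moreover have "cmod (g x) \<le> M k" if x: "of_int k \<le> x" "x \<le> of_int k + 1" for k x
  proof -
    let ?S = "{real_of_int k <..< real_of_int k + 1}"
    let ?C = "{x. cmod (g x) \<le> M k}"
    have C: "closed ?C" using g by (intro closed_Collect_le continuous_intros)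
    have "AE x in restrict_space lebesgue {real_of_int k .. real_of_int k + 1}. ennreal (cmod (g x)) \<le> E k"
      unfolding E_def by (rule esssup_AE)
    then have "AE x in lebesgue. x \<in> {real_of_int k .. real_of_int k + 1} \<longrightarrow> ennreal (cmod (g x)) \<le> E k"
      by (subst (asm) AE_restrict_space_iff) auto
    then have "AE x\<in>?S in lebesgue. x \<in> ?C"
      by (rule eventually_mono) (auto simp: E_M M0 ennreal_le_iff)
    then have "?S \<subseteq> ?C"
      by (intro subsetI mem_closed_if_AE_lebesgue_open[OF _ C, of ?S]) auto
    then have "closure ?S \<subseteq> ?C" using C by (rule closure_minimal)
    then show ?thesis using x by (auto simp: closure_greaterThanLessThan)
  qed
  ultimately show ?thesis using M0 by blast
qed

text \<open>A unit cell contains a bounded number of the points -t, so sums over \<open>T\<close>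
  are controlled by sums over cells. Cells are taken for -t because the window
  \<open>g (x - t)\<close> near x = 0 sees \<open>g\<close> near -t.\<close>

lemma uniformly_discrete_sum_floor:
  assumes "uniformly_discrete T"
  shows "\<exists>D\<ge>0. \<forall>(\<phi> :: int \<Rightarrow> real) T0. (\<forall>k. 0 \<le> \<phi> k) \<longrightarrow> finite T0 \<longrightarrow> T0 \<subseteq> T \<longrightarrow>
    (\<Sum>t\<in>T0. \<phi> \<lfloor>- t\<rfloor>) \<le> D * (\<Sum>k\<in>(\<lambda>t. \<lfloor>- t\<rfloor>) ` T0. \<phi> k)"
proof -
  obtain \<delta> where \<delta>: "0 < \<delta>" "\<And>t t'. t \<in> T \<Longrightarrow> t' \<in> T \<Longrightarrow> t \<noteq> t' \<Longrightarrow> \<delta> \<le> \<bar>t - t'\<bar>"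
    using assms unfolding uniformly_discrete_def by blast
  \<comment> \<open>Points at distance at least \<delta> have different \<lfloor>t /
    \<delta>\<rfloor>, and over an interval of length 1 this floor takes at most \<lceil>1 /
    \<delta>\<rceil> + 2 values.\<close>
  define D where "D = nat (\<lceil>1 / \<delta>\<rceil> + 2)"
  have card: "card {t \<in> T0. \<lfloor>- t\<rfloor> = k} \<le> D" if T0: "finite T0" "T0 \<subseteq> T" for T0 k
  proof -
    let ?A = "{t \<in> T0. \<lfloor>- t\<rfloor> = k}"
    let ?B = "{\<lfloor>(- of_int k - 1) / \<delta>\<rfloor> .. \<lfloor>- of_int k / \<delta>\<rfloor>}"
    have "inj_on (\<lambda>t. \<lfloor>t / \<delta>\<rfloor>) ?A"
    proof (rule inj_onI, rule ccontr)
      fix t t' assume t: "t \<in> ?A" "t' \<in> ?A" "\<lfloor>t / \<delta>\<rfloor> = \<lfloor>t' / \<delta>\<rfloor>" "t \<noteq> t'"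
      have "\<bar>t / \<delta> - t' / \<delta>\<bar> < 1" using t(3) by linarith
      moreover have "\<bar>t / \<delta> - t' / \<delta>\<bar> = \<bar>t - t'\<bar> / \<delta>"
        using \<delta>(1) by (simp add: diff_divide_distrib[symmetric])
      ultimately show False using \<delta>(2)[of t t'] \<delta>(1) t T0(2) by (auto simp: field_simps)
    qed
    moreover have "(\<lambda>t. \<lfloor>t / \<delta>\<rfloor>) ` ?A \<subseteq> ?B"
    proof (clarsimp, intro conjI floor_mono divide_right_mono)
      fix t :: real
      show "- of_int \<lfloor>- t\<rfloor> - 1 \<le> t" by linarith
      have "t \<le> - of_int \<lfloor>- t\<rfloor>" by linarith
      then have "t / \<delta> \<le> - of_int \<lfloor>- t\<rfloor> / \<delta>" using \<delta>(1) by (intro divide_right_mono) auto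
      then show "t / \<delta> \<le> - (of_int \<lfloor>- t\<rfloor> / \<delta>)" by simp
    qed (use \<delta>(1) in simp)
    ultimately have "card ?A \<le> card ?B"
      by (intro card_inj_on_le[of "\<lambda>t. \<lfloor>t / \<delta>\<rfloor>"]) auto
    also have "\<dots> \<le> D"
    proof -
      have "- of_int k / \<delta> - (- of_int k - 1) / \<delta> = 1 / \<delta>"
        using \<delta>(1) by (simp add: field_simps)
      then have "\<lfloor>- of_int k / \<delta>\<rfloor> - \<lfloor>(- of_int k - 1) / \<delta>\<rfloor> \<le> \<lceil>1 / \<delta>\<rceil> + 1" by linarith
      then show ?thesis by (simp add: D_def)
    qed
    finally show ?thesis .
  qed
  have "(\<Sum>t\<in>T0. \<phi> \<lfloor>- t\<rfloor>) \<le> real D * (\<Sum>k\<in>(\<lambda>t. \<lfloor>- t\<rfloor>) ` T0. \<phi> k)"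
    if \<phi>: "\<forall>k. 0 \<le> \<phi> k" and T0: "finite T0" "T0 \<subseteq> T" for \<phi> :: "int \<Rightarrow> real" and T0
  proof -
    have "(\<Sum>t\<in>T0. \<phi> \<lfloor>- t\<rfloor>) = (\<Sum>k\<in>(\<lambda>t. \<lfloor>- t\<rfloor>) ` T0. \<Sum>t\<in>{t \<in> T0. \<lfloor>- t\<rfloor> = k}. \<phi> \<lfloor>- t\<rfloor>)"
      by (rule sum.image_gen[OF T0(1)])
    also have "\<dots> = (\<Sum>k\<in>(\<lambda>t. \<lfloor>- t\<rfloor>) ` T0. real (card {t \<in> T0. \<lfloor>- t\<rfloor> = k}) * \<phi> k)"
      by (intro sum.cong refl) simp
    also have "\<dots> \<le> (\<Sum>k\<in>(\<lambda>t. \<lfloor>- t\<rfloor>) ` T0. real D * \<phi> k)"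
      using \<phi> card[OF T0] by (intro sum_mono mult_right_mono) auto
    finally show ?thesis by (simp add: sum_distrib_left)
  qed
  then show ?thesis by (intro exI[of _ "real D"]) auto
qed

lemma summable_on_small_tail:
  fixes B :: "'a \<Rightarrow> real"
  assumes B: "B summable_on UNIV" and B0: "\<And>k. 0 \<le> B k" and e: "0 < e"
  shows "\<exists>A0. finite A0 \<and> (\<forall>A. finite A \<longrightarrow> A \<inter> A0 = {} \<longrightarrow> sum B A \<le> e)"
proof -
  have "(sum B \<longlongrightarrow> infsum B UNIV) (finite_subsets_at_top UNIV)"
    using B by (simp add: has_sum_infsum has_sum_def[symmetric])
  then have "\<forall>\<^sub>F A in finite_subsets_at_top UNIV. infsum B UNIV - e < sum B A"
    by (rule order_tendstoD) (use e in simp)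
  then obtain A0 where A0: "finite A0" "infsum B UNIV - e < sum B A0"
    by (auto simp: eventually_finite_subsets_at_top)
  have "sum B A \<le> e" if "finite A" "A \<inter> A0 = {}" for A
  proof -
    have "sum B A + sum B A0 = sum B (A \<union> A0)"
      using that A0(1) by (simp add: sum.union_disjoint)
    also have "\<dots> \<le> infsum B UNIV"
      using B B0 that A0(1) by (intro finite_sum_le_infsum) auto
    finally show ?thesis using A0(2) by linarith
  qed
  then show ?thesis using A0(1) by blast
qed

lemma wiener_sum_translates_bounded:
  assumes "continuous_on UNIV g" "wiener_amalgam g" "uniformly_discrete T"
  shows "\<exists>C\<ge>0. \<forall>T0. finite T0 \<longrightarrow> T0 \<subseteq> T \<longrightarrow> (\<Sum>t\<in>T0. cmod (g (- t))) \<le> C"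
proof -
  obtain M :: "int \<Rightarrow> real" where M: "\<forall>k. 0 \<le> M k" "M summable_on UNIV"
    "\<And>k x. of_int k \<le> x \<Longrightarrow> x \<le> of_int k + 1 \<Longrightarrow> cmod (g x) \<le> M k"
    using wiener_amalgam_majorant[OF assms(1,2)] by blast
  obtain D where D: "0 \<le> D" "\<And>(\<phi> :: int \<Rightarrow> real) T0. (\<forall>k. 0 \<le> \<phi> k) \<Longrightarrow> finite T0 \<Longrightarrow> T0 \<subseteq> T \<Longrightarrow>
    (\<Sum>t\<in>T0. \<phi> \<lfloor>- t\<rfloor>) \<le> D * (\<Sum>k\<in>(\<lambda>t. \<lfloor>- t\<rfloor>) ` T0. \<phi> k)"
    using uniformly_discrete_sum_floor[OF assms(3)] by blast
  have "(\<Sum>t\<in>T0. cmod (g (- t))) \<le> D * infsum M UNIV" if "finite T0" "T0 \<subseteq> T" for T0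
  proof -
    have "(\<Sum>t\<in>T0. cmod (g (- t))) \<le> (\<Sum>t\<in>T0. M \<lfloor>- t\<rfloor>)"
      by (intro sum_mono M(3)) linarith+
    also have "\<dots> \<le> D * (\<Sum>k\<in>(\<lambda>t. \<lfloor>- t\<rfloor>) ` T0. M k)"
      by (rule D(2)[OF M(1) that])
    also have "\<dots> \<le> D * infsum M UNIV"
      using D(1) M that by (intro mult_left_mono finite_sum_le_infsum) auto
    finally show ?thesis .
  qed
  then show ?thesis using D(1) M(1) by (intro exI[of _ "D * infsum M UNIV"]) (auto simp: infsum_nonneg)
qed

text \<open>Continuity alone cannot make a sum over infinitely many \<open>t\<close> small. The
  cells are split: outside a finite set \<open>A0\<close> the amalgam majorant has small sum for
  every \<open>l\<close> up to 1, and on \<open>A0\<close> uniform continuity allows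
  \<open>l\<close> to be shrunk.\<close>

lemma wiener_sum_oscillation_small:
  assumes g: "continuous_on UNIV g" and "wiener_amalgam g" "uniformly_discrete T" and \<eta>: "0 < \<eta>"
  shows "\<exists>l d. 0 < l \<and> (\<forall>t. \<forall>x\<in>{0..l}. cmod (g (x - t) - g (- t)) \<le> d t) \<and>
    (\<forall>T0. finite T0 \<longrightarrow> T0 \<subseteq> T \<longrightarrow> (\<Sum>t\<in>T0. d t) \<le> \<eta>)"
proof -
  obtain M :: "int \<Rightarrow> real" where M: "\<forall>k. 0 \<le> M k" "M summable_on UNIV"
    "\<And>k x. of_int k \<le> x \<Longrightarrow> x \<le> of_int k + 1 \<Longrightarrow> cmod (g x) \<le> M k"
    using wiener_amalgam_majorant[OF assms(1,2)] by blast
  obtain D where D: "0 \<le> D" "\<And>(\<phi> :: int \<Rightarrow> real) T0. (\<forall>k. 0 \<le> \<phi> k) \<Longrightarrow> finite T0 \<Longrightarrow> T0 \<subseteq> T \<Longrightarrow>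
    (\<Sum>t\<in>T0. \<phi> \<lfloor>- t\<rfloor>) \<le> D * (\<Sum>k\<in>(\<lambda>t. \<lfloor>- t\<rfloor>) ` T0. \<phi> k)"
    using uniformly_discrete_sum_floor[OF assms(3)] by blast
  \<comment> \<open>If -t lies in cell k and 0 <= x <= 1, then x - t lies in cell k or k + 1; one
    further \<open>M k\<close> pays for \<open>g (- t)\<close>.\<close>
  define B where "B k = 2 * M k + M (k + 1)" for k
  have B0: "0 \<le> B k" for k using M(1) by (simp add: B_def)
  have "(\<lambda>k. M (k + 1)) summable_on UNIV"
    using M(2) by (subst summable_on_reindex_bij_betw[of "\<lambda>k. k + 1" UNIV UNIV M])
      (auto intro: bij_betw_byWitness[of _ "\<lambda>k. k - 1"])
  then have B: "B summable_on UNIV"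
    unfolding B_def using M(2) by (intro summable_on_add summable_on_cmult_right) auto
  \<comment> \<open>The cells outside \<open>A0\<close> and those inside it get a budget
    \<open>e\<close> each, the latter divided equally into shares \<open>e'\<close>; multiplicity
    \<open>D\<close> then gives D * 2e <= \<eta>. The added ones keep the denominators
    positive.\<close>
  define e where "e = \<eta> / (2 * (D + 1))"
  have e: "0 < e" using \<eta> D(1) by (simp add: e_def)
  obtain A0 where A0: "finite A0" "\<And>A. finite A \<Longrightarrow> A \<inter> A0 = {} \<Longrightarrow> sum B A \<le> e"
    using summable_on_small_tail[OF B B0 e] by blast
  define e' where "e' = e / (real (card A0) + 1)"
  have e': "0 < e'" using e by (simp add: e'_def)
  obtain R where R: "\<And>k. k \<in> A0 \<Longrightarrow> \<bar>real_of_int k\<bar> \<le> R"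
    using A0(1) finite_imageI[of A0 "\<lambda>k. \<bar>real_of_int k\<bar>"]
    by (metis Max_ge imageI)
  have "uniformly_continuous_on {-R-2..R+2} g"
    by (intro compact_uniformly_continuous continuous_on_subset[OF g]) auto
  then obtain r where r: "0 < r"
    "\<And>x y. x \<in> {-R-2..R+2} \<Longrightarrow> y \<in> {-R-2..R+2} \<Longrightarrow> dist y x < r \<Longrightarrow> dist (g y) (g x) < e'"
    unfolding uniformly_continuous_on_def using e' by metis
  \<comment> \<open>The bound 1 confines x - t to two cells and to the compact interval; r/2 makes
    the distance strictly less than \<open>r\<close>.\<close>
  define l where "l = min 1 (r / 2)"
  define \<phi> where "\<phi> k = (if k \<in> A0 then e' else B k)" for k
  have \<phi>0: "\<forall>k. 0 \<le> \<phi> k" using e' B0 by (simp add: \<phi>_def)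
  have osc: "cmod (g (x - t) - g (- t)) \<le> \<phi> \<lfloor>- t\<rfloor>" if x: "x \<in> {0..l}" for x t
  proof (cases "\<lfloor>- t\<rfloor> \<in> A0")
    case True
    have "\<bar>x\<bar> < r" "0 \<le> x" "x \<le> 1" using x r(1) by (auto simp: l_def)
    moreover have "\<bar>of_int \<lfloor>- t\<rfloor>\<bar> \<le> R" by (rule R[OF True])
    then have "- t \<in> {-R-1..R+1}" by (simp add: abs_le_iff) linarith
    ultimately show ?thesis
      using r(2)[of "- t" "x - t"] True by (auto simp: \<phi>_def dist_norm)
  next
    case False
    define k where "k = \<lfloor>- t\<rfloor>"
    have k: "of_int k \<le> - t" "- t \<le> of_int k + 1" unfolding k_def by linarith+
    have x01: "0 \<le> x" "x \<le> 1" using x by (auto simp: l_def)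
    have "cmod (g (x - t)) \<le> M k + M (k + 1)"
    proof (cases "x - t \<le> of_int k + 1")
      case True
      then show ?thesis using M(3)[of k "x - t"] k x01 M(1) by (smt (verit))
    next
      case False
      then show ?thesis using M(3)[of "k + 1" "x - t"] k x01 M(1)[rule_format, of k] by simp
    qed
    then have "cmod (g (x - t) - g (- t)) \<le> B k"
      using norm_triangle_ineq4[of "g (x - t)" "g (- t)"] M(3)[OF k] by (simp add: B_def)
    then show ?thesis using False by (simp add: \<phi>_def k_def)
  qed
  have "(\<Sum>t\<in>T0. \<phi> \<lfloor>- t\<rfloor>) \<le> \<eta>" if T0: "finite T0" "T0 \<subseteq> T" for T0
  proof -
    let ?A = "(\<lambda>t. \<lfloor>- t\<rfloor>) ` T0"
    have "sum \<phi> ?A = sum \<phi> (?A - A0) + sum \<phi> (?A \<inter> A0)"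
      using sum.Int_Diff[of ?A \<phi> A0] T0(1) by simp
    also have "sum \<phi> (?A - A0) = sum B (?A - A0)"
      by (intro sum.cong) (auto simp: \<phi>_def)
    also have "sum B (?A - A0) \<le> e" using T0(1) by (intro A0(2)) auto
    also have "sum \<phi> (?A \<inter> A0) = card (?A \<inter> A0) * e'"
      by (simp add: \<phi>_def)
    also have "\<dots> \<le> (real (card A0) + 1) * e'"
      using card_mono[OF A0(1), of "?A \<inter> A0"] e' by (intro mult_right_mono) auto
    also have "\<dots> = e" by (simp add: e'_def)
    finally have "sum \<phi> ?A \<le> 2 * e" by simp
    then have "(\<Sum>t\<in>T0. \<phi> \<lfloor>- t\<rfloor>) \<le> D * (2 * e)"
      using D(2)[OF \<phi>0 T0] mult_left_mono[of "sum \<phi> ?A" "2 * e" D] D(1) by linarith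
    also have "\<dots> \<le> (D + 1) * (2 * e)" using e by (intro mult_right_mono) auto
    also have "\<dots> = \<eta>" using D(1) by (simp add: e_def field_simps)
    finally show ?thesis .
  qed
  then show ?thesis
    using osc r(1) by (intro exI[of _ l] exI[of _ "\<lambda>t. \<phi> \<lfloor>- t\<rfloor>"]) (auto simp: l_def)
qed

section \<open>Pairings with unconditional frames\<close>

lemma Lp_dual_linear:
  assumes \<phi>: "\<phi> \<in> Lp_dual p" and f: "f \<in> Lp p"
  shows "h \<in> Lp p \<Longrightarrow> \<phi> (\<lambda>x. f x + h x) = \<phi> f + \<phi> h" "\<phi> (\<lambda>x. a * f x) = a * \<phi> f"
proof -
  have lin: "\<And>h a b. h \<in> Lp p \<Longrightarrow> \<phi> (\<lambda>x. a * f x + b * h x) = a * \<phi> f + b * \<phi> h"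
    using \<phi> f by (auto simp: Lp_dual_def)
  show "h \<in> Lp p \<Longrightarrow> \<phi> (\<lambda>x. f x + h x) = \<phi> f + \<phi> h" using lin[of h 1 1] by simp
  show "\<phi> (\<lambda>x. a * f x) = a * \<phi> f" using lin[OF f, of a 0] by simp
qed

lemma Lp_dual_sum:
  assumes \<phi>: "\<phi> \<in> Lp_dual p" and p: "0 < p" and "finite A" and f: "\<And>k. k \<in> A \<Longrightarrow> f k \<in> Lp p"
  shows "\<phi> (\<lambda>x. \<Sum>k\<in>A. a k * f k x) = (\<Sum>k\<in>A. a k * \<phi> (f k))"
  using assms(3) f
proof (induction A rule: finite_induct)
  case empty
  show ?case using Lp_dual_linear(2)[OF \<phi> Lp_zero, of 0] by simp
next
  case (insert k A)
  have "\<phi> (\<lambda>x. a k * f k x + (\<Sum>k\<in>A. a k * f k x)) = \<phi> (\<lambda>x. a k * f k x) + \<phi> (\<lambda>x. \<Sum>k\<in>A. a k * f k x)"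
    using insert.prems by (intro Lp_dual_linear(1)[OF \<phi>] Lp_cmult Lp_sum p) auto
  moreover have "\<phi> (\<lambda>x. a k * f k x) = a k * \<phi> (f k)"
    using insert.prems by (intro Lp_dual_linear(2)[OF \<phi>]) auto
  ultimately show ?case using insert by simp
qed

text \<open>The scalar fact that unconditional means absolute: the real and imaginary parts, each
  split by sign, give four subset sums.\<close>

lemma sum_cmod_le_of_partial_sums:
  fixes z :: "'a \<Rightarrow> complex"
  assumes "finite F" and M: "\<And>G. G \<subseteq> F \<Longrightarrow> cmod (\<Sum>n\<in>G. z n) \<le> M"
  shows "(\<Sum>n\<in>F. cmod (z n)) \<le> 4 * M"
proof -
  have real: "(\<Sum>n\<in>F. \<bar>r n\<bar>) \<le> 2 * M" if r: "\<And>G. G \<subseteq> F \<Longrightarrow> \<bar>\<Sum>n\<in>G. r n\<bar> \<le> M" for r :: "'a \<Rightarrow> real"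
  proof -
    let ?P = "{n \<in> F. 0 \<le> r n}"
    have "(\<Sum>n\<in>F. \<bar>r n\<bar>) = (\<Sum>n\<in>?P. \<bar>r n\<bar>) + (\<Sum>n\<in>F - ?P. \<bar>r n\<bar>)"
      using assms(1) by (subst sum.subset_diff[of ?P F]) auto
    also have "(\<Sum>n\<in>?P. \<bar>r n\<bar>) = (\<Sum>n\<in>?P. r n)" by (intro sum.cong) auto
    also have "(\<Sum>n\<in>F - ?P. \<bar>r n\<bar>) = - (\<Sum>n\<in>F - ?P. r n)"
      unfolding sum_negf[symmetric] by (intro sum.cong) auto
    finally show ?thesis using r[of ?P] r[of "F - ?P"] by auto
  qed
  have "(\<Sum>n\<in>F. cmod (z n)) \<le> (\<Sum>n\<in>F. \<bar>Re (z n)\<bar> + \<bar>Im (z n)\<bar>)"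
    by (intro sum_mono cmod_le)
  also have "\<dots> \<le> 2 * M + 2 * M"
    unfolding sum.distrib
  proof (intro add_mono real)
    fix G assume G: "G \<subseteq> F"
    show "\<bar>\<Sum>n\<in>G. Re (z n)\<bar> \<le> M" "\<bar>\<Sum>n\<in>G. Im (z n)\<bar> \<le> M"
      using M[OF G] abs_Re_le_cmod[of "\<Sum>n\<in>G. z n"] abs_Im_le_cmod[of "\<Sum>n\<in>G. z n"] by simp_all
  qed
  finally show ?thesis by simp
qed

text \<open>Uniform boundedness for the seminorms that measure finite partial sums. For a fixed
  \<open>f\<close> they are bounded: some fixed finite \<open>F0\<close> makes the sum over F
  \<union> F0 stay within 1 of \<open>f\<close>, and removing F0 - F costs at most the finitely many
  terms of \<open>F0\<close>.\<close>

lemma unconditional_frame_partial_sums_bounded: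
  assumes p: "1 \<le> p" and frame: "unconditional_schauder_frame p N u c"
  shows "\<exists>K\<ge>0. \<forall>F. finite F \<longrightarrow> F \<subseteq> N \<longrightarrow> (\<forall>f\<in>Lp p.
    lp_norm p (\<lambda>x. \<Sum>n\<in>F. c n f * u n x) \<le> K * lp_norm p f)"
proof -
  have p0: "0 < p" using p by simp
  have u: "u n \<in> Lp p" and c: "c n \<in> Lp_dual p" if "n \<in> N" for n
    using frame that by (auto simp: unconditional_schauder_frame_def)
  define S where "S F f = lp_norm p (\<lambda>x. \<Sum>n\<in>F. c n f * u n x)" for F f
  define I where "I = {F. finite F \<and> F \<subseteq> N}"
  have SL: "(\<lambda>x. \<Sum>n\<in>F. c n f * u n x) \<in> Lp p" if "F \<in> I" for F f
    using that u by (intro Lp_sum p0 Lp_cmult) (auto simp: I_def)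
  have S_le: "S F f \<le> (\<Sum>n\<in>F. cmod (c n f) * lp_norm p (u n))" if "F \<in> I" for F f
  proof -
    have "S F f \<le> (\<Sum>n\<in>F. lp_norm p (\<lambda>x. c n f * u n x))"
      unfolding S_def using that u by (intro lp_norm_sum_le p Lp_cmult) (auto simp: I_def)
    then show ?thesis by (simp add: lp_norm_cmult p0)
  qed
  have "\<exists>K\<ge>0. \<forall>F\<in>I. \<forall>f\<in>Lp p. S F f \<le> K * lp_norm p f"
  proof (rule Lp_uniform_boundedness[OF p])
    show "0 \<le> S F f" for F f by (simp add: S_def lp_norm_nonneg)
  next
    fix F assume F: "F \<in> I"
    have "\<exists>C. \<forall>f\<in>Lp p. cmod (c n f) \<le> C * lp_norm p f" if "n \<in> F" for n
      using c[of n] that F by (auto simp: Lp_dual_def I_def)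
    then obtain C where C: "\<And>n f. n \<in> F \<Longrightarrow> f \<in> Lp p \<Longrightarrow> cmod (c n f) \<le> C n * lp_norm p f"
      by metis
    have "S F f \<le> (\<Sum>n\<in>F. C n * lp_norm p (u n)) * lp_norm p f" if "f \<in> Lp p" for f
    proof -
      have "S F f \<le> (\<Sum>n\<in>F. (C n * lp_norm p f) * lp_norm p (u n))"
        by (rule order.trans[OF S_le[OF F]]) (intro sum_mono mult_right_mono C that lp_norm_nonneg)
      then show ?thesis by (simp add: sum_distrib_left sum_distrib_right mult_ac)
    qed
    then show "\<exists>C. \<forall>f\<in>Lp p. S F f \<le> C * lp_norm p f" by blast
  next
    fix F f h assume F: "F \<in> I" and f: "f \<in> Lp p" and h: "h \<in> Lp p"
    have "c n (\<lambda>x. f x + h x) = c n f + c n h" if "n \<in> F" for n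
      using that F c by (intro Lp_dual_linear(1)[OF _ f h]) (auto simp: I_def)
    then have "(\<lambda>x. \<Sum>n\<in>F. c n (\<lambda>x. f x + h x) * u n x)
        = (\<lambda>x. (\<Sum>n\<in>F. c n f * u n x) + (\<Sum>n\<in>F. c n h * u n x))"
      by (simp add: sum.distrib[symmetric] distrib_right)
    then show "S F (\<lambda>x. f x + h x) \<le> S F f + S F h"
      unfolding S_def by (simp only:) (intro lp_norm_triangle p SL F)
  next
    fix F f and a :: complex assume F: "F \<in> I" and f: "f \<in> Lp p"
    have "c n (\<lambda>x. a * f x) = a * c n f" if "n \<in> F" for n
      using that F c by (intro Lp_dual_linear(2)[OF _ f]) (auto simp: I_def)
    then have "(\<lambda>x. \<Sum>n\<in>F. c n (\<lambda>x. a * f x) * u n x) = (\<lambda>x. a * (\<Sum>n\<in>F. c n f * u n x))"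
      by (simp add: sum_distrib_left mult.assoc)
    then show "S F (\<lambda>x. a * f x) = cmod a * S F f"
      unfolding S_def by (simp only: lp_norm_cmult[OF p0])
  next
    fix f assume f: "f \<in> Lp p"
    obtain F0 where F0: "finite F0" "F0 \<subseteq> N" "\<And>F. finite F \<Longrightarrow> F0 \<subseteq> F \<Longrightarrow> F \<subseteq> N \<Longrightarrow>
        lp_norm p (\<lambda>x. f x - (\<Sum>n\<in>F. c n f * u n x)) < 1"
      using frame f unfolding unconditional_schauder_frame_def by (meson zero_less_one)
    define C where "C = (\<Sum>n\<in>F0. cmod (c n f) * lp_norm p (u n))"
    have "S F f \<le> lp_norm p f + 1 + C" if F: "F \<in> I" for F
    proof -
      let ?s = "\<lambda>G x. \<Sum>n\<in>G. c n f * u n x"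
      have G: "F \<union> F0 \<in> I" "F0 - F \<in> I" using F F0 by (auto simp: I_def)
      have "?s F = (\<lambda>x. f x - (f x - ?s (F \<union> F0) x) - ?s (F0 - F) x)"
      proof
        fix x
        have "?s (F \<union> (F0 - F)) x = ?s F x + ?s (F0 - F) x"
          using F F0 by (intro sum.union_disjoint) (auto simp: I_def)
        moreover have "F \<union> (F0 - F) = F \<union> F0" by auto
        ultimately show "?s F x = f x - (f x - ?s (F \<union> F0) x) - ?s (F0 - F) x" by simp
      qed
      then have "S F f = lp_norm p (\<lambda>x. f x - (f x - ?s (F \<union> F0) x) - ?s (F0 - F) x)"
        by (simp only: S_def)
      also have "\<dots> \<le> lp_norm p (\<lambda>x. f x - (f x - ?s (F \<union> F0) x)) + S (F0 - F) f"
        unfolding S_def by (intro lp_norm_triangle_diff p Lp_diff p0 f SL G)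
      also have "lp_norm p (\<lambda>x. f x - (f x - ?s (F \<union> F0) x))
          \<le> lp_norm p f + lp_norm p (\<lambda>x. f x - ?s (F \<union> F0) x)"
        by (intro lp_norm_triangle_diff p Lp_diff p0 f SL G)
      also have "lp_norm p (\<lambda>x. f x - ?s (F \<union> F0) x) \<le> 1"
        using F0(3)[of "F \<union> F0"] G by (auto simp: I_def)
      also have "S (F0 - F) f \<le> C"
        unfolding C_def using F0(1)
        by (intro order.trans[OF S_le[OF G(2)]] sum_mono2) (auto simp: lp_norm_nonneg)
      finally show ?thesis by simp
    qed
    then show "\<exists>C. \<forall>F\<in>I. S F f \<le> C" by blast
  qed
  then show ?thesis by (auto simp: I_def S_def)
qed

text \<open>The quantitative content of unconditionality. Hoelder bounds the paired sum over every
  subset of \<open>F\<close>, and bounded subset sums bound the sum of moduli.\<close>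

lemma unconditional_frame_pairing_bounded:
  assumes pq: "1 < p" "1 < q" "1 / p + 1 / q = 1" and frame: "unconditional_schauder_frame p N u c"
  shows "\<exists>K\<ge>0. \<forall>F. finite F \<longrightarrow> F \<subseteq> N \<longrightarrow> (\<forall>f\<in>Lp p. \<forall>h\<in>Lp q.
    (\<Sum>n\<in>F. cmod (c n f) * cmod (\<integral>x. u n x * h x \<partial>lebesgue)) \<le> K * lp_norm p f * lp_norm q h)"
proof -
  have u: "u n \<in> Lp p" if "n \<in> N" for n
    using frame that by (auto simp: unconditional_schauder_frame_def)
  obtain K where K: "0 \<le> K" "\<And>F f. finite F \<Longrightarrow> F \<subseteq> N \<Longrightarrow> f \<in> Lp p \<Longrightarrow>
      lp_norm p (\<lambda>x. \<Sum>n\<in>F. c n f * u n x) \<le> K * lp_norm p f"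
    using unconditional_frame_partial_sums_bounded[OF _ frame] pq by auto
  have "(\<Sum>n\<in>F. cmod (c n f) * cmod (\<integral>x. u n x * h x \<partial>lebesgue)) \<le> 4 * (K * lp_norm p f * lp_norm q h)"
    if F: "finite F" "F \<subseteq> N" and f: "f \<in> Lp p" and h: "h \<in> Lp q" for F f h
    unfolding norm_mult[symmetric]
  proof (rule sum_cmod_le_of_partial_sums[OF F(1)])
    fix G assume G: "G \<subseteq> F"
    then have G': "finite G" "G \<subseteq> N" using F finite_subset by auto
    have int: "integrable lebesgue (\<lambda>x. u n x * h x)" if "n \<in> G" for n
      using that G' by (intro Lp_Holder(1)[OF pq _ h] u) auto
    have "(\<Sum>n\<in>G. c n f * (\<integral>x. u n x * h x \<partial>lebesgue)) = (\<integral>x. (\<Sum>n\<in>G. c n f * u n x) * h x \<partial>lebesgue)"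
      using int by (simp add: sum_distrib_right mult.assoc)
    also have "cmod \<dots> \<le> lp_norm p (\<lambda>x. \<Sum>n\<in>G. c n f * u n x) * lp_norm q h"
      using G' pq u by (intro Lp_Holder(2)[OF pq _ h] Lp_sum Lp_cmult) auto
    also have "\<dots> \<le> K * lp_norm p f * lp_norm q h"
      by (intro mult_right_mono K(2)[OF G' f] lp_norm_nonneg)
    finally show "cmod (\<Sum>n\<in>G. c n f * (\<integral>x. u n x * h x \<partial>lebesgue)) \<le> K * lp_norm p f * lp_norm q h" .
  qed
  then show ?thesis using K(1) by (intro exI[of _ "4 * K"]) (auto simp: mult.assoc)
qed

text \<open>Hoelder applied to the remainder of the expansion. The estimate is kept for all finite
  supersets of \<open>F0\<close>, so that one finite set can later serve several pairs
  \<open>f\<close>, \<open>h\<close>.\<close>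

lemma frame_pairing_approximation:
  assumes pq: "1 < p" "1 < q" "1 / p + 1 / q = 1" and frame: "unconditional_schauder_frame p N u c"
    and f: "f \<in> Lp p" and h: "h \<in> Lp q" and e: "0 < e"
  shows "\<exists>F0. finite F0 \<and> F0 \<subseteq> N \<and> (\<forall>F. finite F \<longrightarrow> F0 \<subseteq> F \<longrightarrow> F \<subseteq> N \<longrightarrow>
    cmod ((\<integral>x. f x * h x \<partial>lebesgue) - (\<Sum>n\<in>F. c n f * (\<integral>x. u n x * h x \<partial>lebesgue))) \<le> e)"
proof -
  have u: "u n \<in> Lp p" if "n \<in> N" for n
    using frame that by (auto simp: unconditional_schauder_frame_def)
  have e': "0 < e / (lp_norm q h + 1)" using e lp_norm_nonneg[of q h] by (simp add: add_nonneg_pos)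
  obtain F0 where F0: "finite F0" "F0 \<subseteq> N" "\<And>F. finite F \<Longrightarrow> F0 \<subseteq> F \<Longrightarrow> F \<subseteq> N \<Longrightarrow>
      lp_norm p (\<lambda>x. f x - (\<Sum>n\<in>F. c n f * u n x)) < e / (lp_norm q h + 1)"
    using frame f e' unfolding unconditional_schauder_frame_def by meson
  have "cmod ((\<integral>x. f x * h x \<partial>lebesgue) - (\<Sum>n\<in>F. c n f * (\<integral>x. u n x * h x \<partial>lebesgue))) \<le> e"
    if F: "finite F" "F0 \<subseteq> F" "F \<subseteq> N" for F
  proof -
    let ?D = "\<lambda>x. f x - (\<Sum>n\<in>F. c n f * u n x)"
    have D: "?D \<in> Lp p" using F pq u f by (intro Lp_diff Lp_sum Lp_cmult) auto
    have "integrable lebesgue (\<lambda>x. u n x * h x)" if "n \<in> F" for n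
      using that F by (intro Lp_Holder(1)[OF pq _ h] u) auto
    then have "(\<integral>x. f x * h x \<partial>lebesgue) - (\<Sum>n\<in>F. c n f * (\<integral>x. u n x * h x \<partial>lebesgue)) = (\<integral>x. ?D x * h x \<partial>lebesgue)"
      using Lp_Holder(1)[OF pq f h] by (simp add: sum_distrib_right left_diff_distrib mult.assoc)
    also have "cmod \<dots> \<le> lp_norm p ?D * lp_norm q h"
      by (rule Lp_Holder(2)[OF pq D h])
    also have "\<dots> \<le> e / (lp_norm q h + 1) * lp_norm q h"
      using F0(3)[OF F] by (intro mult_right_mono lp_norm_nonneg) simp
    also have "\<dots> \<le> e"
      using e lp_norm_nonneg[of q h] by (simp add: field_simps)
    finally show ?thesis .
  qed
  then show ?thesis using F0 by blast
qed

section \<open>Localization of Gabor systems\<close>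

lemma cmod_modul [simp]: "cmod (modul s x) = 1"
  by (simp add: modul_def)

lemma modul_add: "modul s (x + y) = modul s x * modul s y"
  by (simp add: modul_def distrib_left distrib_right exp_add[symmetric])

lemma continuous_modul: "continuous_on A (modul s)"
  unfolding modul_def by (intro continuous_intros)

lemma continuous_borel_lebesgue:
  fixes f :: "real \<Rightarrow> complex"
  assumes "continuous_on UNIV f" shows "f \<in> borel_measurable lebesgue"
  using borel_measurable_continuous_onI[OF assms] by (simp add: measurable_completion)

lemma integral_lebesgue_shift:
  fixes f :: "real \<Rightarrow> 'a :: euclidean_space"
  shows "(\<integral>x. f (x + a) \<partial>lebesgue) = (\<integral>x. f x \<partial>lebesgue)"
  using lebesgue_integral_real_affine[of 1 f a] by (simp add: add.commute)

lemma Lp_shift: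
  assumes "f \<in> Lp p" shows "(\<lambda>x. f (x + a)) \<in> Lp p"
  using borel_measurable_affine[OF Lp_measurable[OF assms], of 1 a]
    lebesgue_integrable_real_affine[OF Lp_integrable[OF assms], of 1 a]
  by (simp add: Lp_def add.commute)

lemma lp_norm_shift: "lp_norm p (\<lambda>x. f (x + a)) = lp_norm p f"
  unfolding lp_norm_def by (simp add: integral_lebesgue_shift[of "\<lambda>x. cmod (f x) powr p"])

lemma Lp_dominated:
  assumes p: "0 < p" and h: "h \<in> Lp p" and [measurable]: "f \<in> borel_measurable lebesgue"
    and C: "0 \<le> C" and le: "\<And>x. cmod (f x) \<le> C * cmod (h x)"
  shows "f \<in> Lp p" "lp_norm p f \<le> C * lp_norm p h"
proof -
  have pt: "cmod (f x) powr p \<le> C powr p * cmod (h x) powr p" for x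
    using powr_mono2[of p "cmod (f x)" "C * cmod (h x)"] le p C by (simp add: powr_mult)
  have "integrable lebesgue (\<lambda>x. cmod (f x) powr p)"
    by (rule Bochner_Integration.integrable_bound[of lebesgue "\<lambda>x. C powr p * cmod (h x) powr p"])
      (use pt Lp_integrable[OF h] in auto)
  then show f: "f \<in> Lp p" by (simp add: Lp_def)
  have "(\<integral>x. cmod (f x) powr p \<partial>lebesgue) \<le> (\<integral>x. C powr p * cmod (h x) powr p \<partial>lebesgue)"
    using pt Lp_integrable[OF h] Lp_integrable[OF f] by (intro integral_mono) auto
  also have "\<dots> = (C * lp_norm p h) powr p"
    using C p by (simp add: powr_mult lp_norm_nonneg lp_norm_powr)
  finally show "lp_norm p f \<le> C * lp_norm p h"
    using C p by (intro lp_norm_leI) (auto simp: lp_norm_nonneg)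
qed

text \<open>For exponentials a translation only multiplies the pairing by a unimodular constant, so the test
  function can be moved to where \<open>g\<close> is bounded below, and \<open>g\<close> divided out.\<close>

lemma transplant_test_function:
  assumes q: "0 < q" and g: "continuous_on UNIV g" and c0: "0 < c0" "\<And>x. x \<in> {0..l} \<Longrightarrow> c0 \<le> cmod (g (x + z0))"
    and h: "h \<in> Lp q" and h0: "\<And>x. x \<notin> {0..l} \<Longrightarrow> h x = 0"
    and \<rho>: "continuous_on UNIV \<rho>" and d: "0 \<le> d" "\<And>x. x \<in> {0..l} \<Longrightarrow> cmod (\<rho> x) \<le> d"
  shows "\<exists>h'\<in>Lp q. lp_norm q h' \<le> d / c0 * lp_norm q h \<and>
    (\<forall>s. cmod (\<integral>x. (modul s x * transl t g x) * h' x \<partial>lebesgue) = cmod (\<integral>x. modul s x * (\<rho> x * h x) \<partial>lebesgue))"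
proof -
  \<comment> \<open>Off \<open>{0..l}\<close>, where \<open>g (x + z0)\<close> may vanish,
    \<open>h x = 0\<close> makes the quotient 0 in any case.\<close>
  define H where "H x = \<rho> x * h x / g (x + z0)" for x
  note [measurable] = Lp_measurable[OF h] continuous_borel_lebesgue[OF \<rho>]
  have "continuous_on UNIV (\<lambda>x. g (x + z0))"
    by (intro continuous_on_compose2[OF g] continuous_intros) auto
  note [measurable] = continuous_borel_lebesgue[OF this]
  have H_meas: "H \<in> borel_measurable lebesgue" unfolding H_def by measurable
  have H_le: "cmod (H x) \<le> d / c0 * cmod (h x)" for x
  proof (cases "x \<in> {0..l}")
    case True
    have "cmod (\<rho> x) / cmod (g (x + z0)) \<le> d / c0"
      using c0 d True by (intro frac_le) auto
    then have "cmod (\<rho> x) / cmod (g (x + z0)) * cmod (h x) \<le> d / c0 * cmod (h x)"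
      by (intro mult_right_mono) auto
    then show ?thesis by (simp add: H_def norm_divide norm_mult)
  qed (simp add: H_def h0)
  have HL: "H \<in> Lp q" and H_norm: "lp_norm q H \<le> d / c0 * lp_norm q h"
    using Lp_dominated[OF q h H_meas _ H_le] d(1) c0(1) by auto
  \<comment> \<open>After the substitution x + t + z0 the window is \<open>g (x + z0)\<close> for
    every \<open>t\<close>, hence bounded below by one \<open>c0\<close>; the exponential
    contributes the factor \<open>modul s (t + z0)\<close> of modulus 1.\<close>
  define h' where "h' = (\<lambda>x. H (x + (- t - z0)))"
  have "cmod (\<integral>x. (modul s x * transl t g x) * h' x \<partial>lebesgue) = cmod (\<integral>x. modul s x * (\<rho> x * h x) \<partial>lebesgue)" for s
  proof -
    have "(\<integral>x. (modul s x * transl t g x) * h' x \<partial>lebesgue)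
        = (\<integral>x. (modul s (x + (t + z0)) * transl t g (x + (t + z0))) * h' (x + (t + z0)) \<partial>lebesgue)"
      by (rule integral_lebesgue_shift[symmetric])
    also have "\<dots> = (\<integral>x. modul s (t + z0) * (modul s x * (\<rho> x * h x)) \<partial>lebesgue)"
    proof (intro Bochner_Integration.integral_cong refl)
      fix x
      have "g (x + z0) * H x = \<rho> x * h x"
      proof (cases "x \<in> {0..l}")
        case True
        then have "g (x + z0) \<noteq> 0" using c0 by force
        then show ?thesis by (simp add: H_def)
      qed (simp add: H_def h0)
      moreover have "transl t g (x + (t + z0)) = g (x + z0)" "h' (x + (t + z0)) = H x"
        by (simp_all add: transl_def h'_def add.commute)
      ultimately show "(modul s (x + (t + z0)) * transl t g (x + (t + z0))) * h' (x + (t + z0))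
          = modul s (t + z0) * (modul s x * (\<rho> x * h x))"
        unfolding modul_add[of s x] by (simp add: mult_ac)
    qed
    finally show ?thesis by (simp add: norm_mult)
  qed
  moreover have "h' \<in> Lp q" "lp_norm q h' \<le> d / c0 * lp_norm q h"
    unfolding h'_def lp_norm_shift using HL H_norm by (auto intro: Lp_shift)
  ultimately show ?thesis by blast
qed

lemma gabor_modified_window_bound:
  assumes q: "0 < q" and g: "continuous_on UNIV g" and c0: "0 < c0" "\<And>x. x \<in> {0..l} \<Longrightarrow> c0 \<le> cmod (g (x + z0))"
    and K: "0 \<le> K" "\<And>F f h. finite F \<Longrightarrow> F \<subseteq> \<Lambda> \<Longrightarrow> f \<in> Lp p \<Longrightarrow> h \<in> Lp q \<Longrightarrow>
      (\<Sum>(t, s)\<in>F. cmod (c (t, s) f) * cmod (\<integral>x. (modul s x * transl t g x) * h x \<partial>lebesgue))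
        \<le> K * lp_norm p f * lp_norm q h"
    and h: "h \<in> Lp q" "\<And>x. x \<notin> {0..l} \<Longrightarrow> h x = 0" and f: "f \<in> Lp p"
    and \<rho>: "\<And>t. continuous_on UNIV (\<rho> t)" and d: "\<And>t. 0 \<le> d t" "\<And>t x. x \<in> {0..l} \<Longrightarrow> cmod (\<rho> t x) \<le> d t"
    and F: "finite F" "F \<subseteq> \<Lambda>" and D: "(\<Sum>t\<in>fst ` F. d t) \<le> D"
  shows "(\<Sum>(t, s)\<in>F. cmod (c (t, s) f) * cmod (\<integral>x. modul s x * (\<rho> t x * h x) \<partial>lebesgue))
    \<le> K * D / c0 * lp_norm p f * lp_norm q h"
proof -
  define y where "y = (\<lambda>(t, s). cmod (c (t, s) f) * cmod (\<integral>x. modul s x * (\<rho> t x * h x) \<partial>lebesgue))"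
  \<comment> \<open>The transplanted test function depends on \<open>t\<close> but not on
    \<open>s\<close>, so the bound \<open>K\<close> applies to one whole fibre at a time.\<close>
  have fibre: "sum y {n \<in> F. fst n = t} \<le> (K / c0 * lp_norm p f * lp_norm q h) * d t" for t
  proof -
    let ?F = "{n \<in> F. fst n = t}"
    obtain h' where h': "h' \<in> Lp q" "lp_norm q h' \<le> d t / c0 * lp_norm q h"
      "\<And>s. cmod (\<integral>x. (modul s x * transl t g x) * h' x \<partial>lebesgue) = cmod (\<integral>x. modul s x * (\<rho> t x * h x) \<partial>lebesgue)"
      using transplant_test_function[OF q g c0 h \<rho> d] by blast
    have "sum y ?F = (\<Sum>(t, s)\<in>?F. cmod (c (t, s) f) * cmod (\<integral>x. (modul s x * transl t g x) * h' x \<partial>lebesgue))"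
      by (intro sum.cong) (auto simp: y_def h'(3))
    also have "\<dots> \<le> K * lp_norm p f * lp_norm q h'"
      using F h' f by (intro K) auto
    also have "\<dots> \<le> K * lp_norm p f * (d t / c0 * lp_norm q h)"
      using K(1) h'(2) by (intro mult_left_mono) (auto simp: lp_norm_nonneg)
    finally show ?thesis by (simp add: mult_ac)
  qed
  have "sum y F = (\<Sum>t\<in>fst ` F. sum y {n \<in> F. fst n = t})"
    by (rule sum.image_gen[OF F(1)])
  also have "\<dots> \<le> (K / c0 * lp_norm p f * lp_norm q h) * (\<Sum>t\<in>fst ` F. d t)"
    unfolding sum_distrib_left by (intro sum_mono fibre)
  also have "\<dots> \<le> (K / c0 * lp_norm p f * lp_norm q h) * D"
    using K(1) c0(1) by (intro mult_left_mono D) (auto simp: lp_norm_nonneg)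
  finally show ?thesis by (simp add: y_def mult_ac)
qed

lemma indicator_Lp:
  fixes a b :: real
  assumes p: "0 < p" and "a \<le> b"
  shows "(\<lambda>x. indicator {a..<b} x :: complex) \<in> Lp p"
    and "lp_norm p (\<lambda>x. indicator {a..<b} x :: complex) = (b - a) powr (1 / p)"
proof -
  have eq: "cmod (indicator {a..<b} x) powr p = indicator {a..<b} x" for x :: real
    using p by (simp add: indicator_def)
  have "integrable lebesgue (indicator {a..<b} :: real \<Rightarrow> real)"
    using assms by (simp add: integrable_indicator_iff)
  then show "(\<lambda>x. indicator {a..<b} x :: complex) \<in> Lp p"
    by (simp add: Lp_def eq borel_measurable_indicator)
  show "lp_norm p (\<lambda>x. indicator {a..<b} x :: complex) = (b - a) powr (1 / p)"
    using assms by (simp add: lp_norm_def eq)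
qed

text \<open>\<open>modul s\<close> is not in \<open>Lp p\<close>; cutting it off with the indicator
  of \<open>{0..<l+1}\<close> makes Hoelder applicable. The extra unit covers the endpoint
  \<open>l\<close> of the support of \<open>h\<close>.\<close>

lemma integrable_modul_mult:
  assumes pq: "1 < p" "1 < q" "1 / p + 1 / q = 1" and h: "h \<in> Lp q" "\<And>x. x \<notin> {0..l} \<Longrightarrow> h x = 0" and l: "0 \<le> l"
  shows "integrable lebesgue (\<lambda>x. modul s x * h x)"
proof -
  have "(\<lambda>x. modul s x * indicator {0..<l+1} x) \<in> borel_measurable lebesgue"
    by (intro borel_measurable_times borel_measurable_indicator continuous_borel_lebesgue continuous_modul) simp
  then have "(\<lambda>x. modul s x * indicator {0..<l+1} x) \<in> Lp p"
    using pq l by (intro Lp_dominated[OF _ indicator_Lp(1)[of p 0 "l + 1"], of _ 1]) (auto simp: norm_mult)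
  then have "integrable lebesgue (\<lambda>x. (modul s x * indicator {0..<l+1} x) * h x)"
    by (rule Lp_Holder(1)[OF pq _ h(1)])
  moreover have "modul s x * indicator {0..<l+1} x * h x = modul s x * h x" for x
    by (cases "x \<in> {0..l}") (auto simp: indicator_def h(2))
  ultimately show ?thesis by simp
qed

text \<open>With g = 0 all frame expansions vanish and cannot come within distance less than 1 of a
  function of norm 1. This supplies the point where \<open>g\<close> can be divided out.\<close>

lemma gabor_frame_window_nonzero:
  assumes p: "1 < p" and frame: "unconditional_schauder_frame p \<Lambda> (\<lambda>(t, s). \<lambda>x. modul s x * transl t g x) c"
  shows "\<exists>z. g z \<noteq> 0"
proof (rule ccontr)
  assume "\<not> ?thesis"
  then have "g z = 0" for z by blast
  then have [simp]: "g = (\<lambda>x. 0)" by auto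
  let ?f = "\<lambda>x. indicator {0..<1::real} x :: complex"
  have "?f \<in> Lp p" using p by (intro indicator_Lp) auto
  then obtain F0 where "finite F0" "F0 \<subseteq> \<Lambda>"
    "lp_norm p (\<lambda>x. ?f x - (\<Sum>n\<in>F0. c n ?f * (case n of (t, s) \<Rightarrow> \<lambda>x. modul s x * transl t g x) x)) < 1"
    using frame unfolding unconditional_schauder_frame_def by (meson order_refl zero_less_one)
  moreover have "(case n of (t, s) \<Rightarrow> \<lambda>x. modul s x * transl t g x) x = 0" for n and x :: real
    by (simp add: transl_def split: prod.split)
  ultimately show False using indicator_Lp(2)[of p 0 1] p by simp
qed

text \<open>On a short interval \<open>g (x - t)\<close> may be replaced by \<open>g (- t)\<close>, at the cost of a small multiple of the
  identity: the localized system consists of multiples of exponentials.\<close>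

lemma gabor_frame_localization:
  assumes pq: "1 < p" "1 < q" "1 / p + 1 / q = 1"
    and g: "continuous_on UNIV g" "wiener_amalgam g" and T: "uniformly_discrete T" and \<Lambda>: "\<Lambda> \<subseteq> T \<times> UNIV"
    and frame: "unconditional_schauder_frame p \<Lambda> (\<lambda>(t, s). \<lambda>x. modul s x * transl t g x) c"
  shows "\<exists>l>0. \<exists>K\<ge>0. \<forall>f\<in>Lp p. \<forall>h\<in>Lp q. (\<forall>x. x \<notin> {0..l} \<longrightarrow> h x = 0) \<longrightarrow>
    (\<forall>F. finite F \<longrightarrow> F \<subseteq> \<Lambda> \<longrightarrow>
      (\<Sum>(t, s)\<in>F. cmod (c (t, s) f) * (cmod (g (- t)) * cmod (\<integral>x. modul s x * h x \<partial>lebesgue)))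
        \<le> K * lp_norm p f * lp_norm q h) \<and>
    (\<forall>e>0. \<exists>F0. finite F0 \<and> F0 \<subseteq> \<Lambda> \<and> (\<forall>F. finite F \<longrightarrow> F0 \<subseteq> F \<longrightarrow> F \<subseteq> \<Lambda> \<longrightarrow>
      cmod (\<integral>x. f x * h x \<partial>lebesgue) \<le> e + 1/4 * lp_norm p f * lp_norm q h +
        (\<Sum>(t, s)\<in>F. cmod (c (t, s) f) * (cmod (g (- t)) * cmod (\<integral>x. modul s x * h x \<partial>lebesgue)))))"
proof -
  obtain z0 where z0: "g z0 \<noteq> 0" using gabor_frame_window_nonzero[OF pq(1) frame] by blast
  define c0 where "c0 = cmod (g z0) / 2"
  have c0: "0 < c0" using z0 by (simp add: c0_def)
  have "isCont g z0" using g(1) by (simp add: continuous_on_eq_continuous_at)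
  then obtain r where r: "0 < r" "\<And>x. dist x z0 < r \<Longrightarrow> dist (g x) (g z0) < c0"
    using c0 unfolding continuous_at_eps_delta by (auto simp: dist_norm)
  have low: "c0 \<le> cmod (g (x + z0))" if "x \<in> {0..r/2}" for x
  proof -
    have "dist (g (x + z0)) (g z0) < c0" using that r(1) by (intro r(2)) (auto simp: dist_norm)
    then have "cmod (g z0) - cmod (g (x + z0)) < c0"
      using norm_triangle_ineq2[of "g z0" "g (x + z0)"] by (simp add: dist_norm norm_minus_commute)
    then show ?thesis by (simp add: c0_def)
  qed
  obtain K where K: "0 \<le> K" and K_raw: "\<And>F f h. finite F \<Longrightarrow> F \<subseteq> \<Lambda> \<Longrightarrow> f \<in> Lp p \<Longrightarrow> h \<in> Lp q \<Longrightarrow>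
      (\<Sum>n\<in>F. cmod (c n f) * cmod (\<integral>x. (case n of (t, s) \<Rightarrow> \<lambda>x. modul s x * transl t g x) x * h x \<partial>lebesgue))
        \<le> K * lp_norm p f * lp_norm q h"
    using unconditional_frame_pairing_bounded[OF pq frame] by (elim exE conjE) (rule that, assumption, simp)
  have K_bound: "(\<Sum>(t, s)\<in>F. cmod (c (t, s) f) * cmod (\<integral>x. (modul s x * transl t g x) * h x \<partial>lebesgue))
        \<le> K * lp_norm p f * lp_norm q h" if "finite F" "F \<subseteq> \<Lambda>" "f \<in> Lp p" "h \<in> Lp q" for F f h
    using K_raw[OF that] by (simp add: case_prod_beta')
  obtain C where C: "0 \<le> C" "\<And>T0. finite T0 \<Longrightarrow> T0 \<subseteq> T \<Longrightarrow> (\<Sum>t\<in>T0. cmod (g (- t))) \<le> C"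
    using wiener_sum_translates_bounded[OF g T] by blast
  \<comment> \<open>An oscillation sum of at most \<eta> costs K \<eta> / c0 <= 1/4 after
    transplantation; K + 1 covers K = 0.\<close>
  define \<eta> where "\<eta> = c0 / (4 * (K + 1))"
  have \<eta>: "0 < \<eta>" using c0 K by (simp add: \<eta>_def)
  obtain l1 d where d: "0 < l1" "\<And>t x. x \<in> {0..l1} \<Longrightarrow> cmod (g (x - t) - g (- t)) \<le> d t"
    "\<And>T0. finite T0 \<Longrightarrow> T0 \<subseteq> T \<Longrightarrow> (\<Sum>t\<in>T0. d t) \<le> \<eta>"
    using wiener_sum_oscillation_small[OF g T \<eta>] by blast
  define l where "l = min (r/2) l1"
  have l: "0 < l" using r(1) d(1) by (simp add: l_def)
  have low_l: "c0 \<le> cmod (g (x + z0))" if "x \<in> {0..l}" for x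
    using that by (intro low) (auto simp: l_def)
  have d_l: "cmod (g (x - t) - g (- t)) \<le> d t" if "x \<in> {0..l}" for x t
    using that by (intro d(2)) (auto simp: l_def)
  have d0: "0 \<le> d t" for t using d_l[of 0 t] l by simp
  have "K * \<eta> / c0 = K / (4 * (K + 1))" using c0 by (simp add: \<eta>_def)
  also have "\<dots> \<le> 1/4" using K by (simp add: divide_le_eq)
  finally have K\<eta>: "K * \<eta> / c0 \<le> 1/4" .
  have fst: "finite (fst ` F)" "fst ` F \<subseteq> T" if "finite F" "F \<subseteq> \<Lambda>" for F
    using that \<Lambda> by auto
  show ?thesis
  proof (rule exI[of _ l], rule conjI[OF l], rule exI[of _ "K * C / c0"], intro conjI ballI impI allI)
    show "0 \<le> K * C / c0" using K C(1) c0 by auto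
  next
    fix f h F assume f: "f \<in> Lp p" and h: "h \<in> Lp q" "\<forall>x. x \<notin> {0..l} \<longrightarrow> h x = 0"
      and F: "finite F" "F \<subseteq> \<Lambda>"
    have "(\<Sum>(t, s)\<in>F. cmod (c (t, s) f) * cmod (\<integral>x. modul s x * (g (- t) * h x) \<partial>lebesgue))
        \<le> K * C / c0 * lp_norm p f * lp_norm q h"
      by (rule gabor_modified_window_bound[where d = "\<lambda>t. cmod (g (- t))", OF _ g(1) c0 low_l K K_bound h(1) _ f _ _ _ F])
        (use pq h(2) C(2)[OF fst[OF F]] in \<open>auto intro: continuous_intros\<close>)
    moreover have "cmod (\<integral>x. modul s x * (g (- t) * h x) \<partial>lebesgue)
        = cmod (g (- t)) * cmod (\<integral>x. modul s x * h x \<partial>lebesgue)" for s t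
    proof -
      have "(\<integral>x. modul s x * (g (- t) * h x) \<partial>lebesgue) = (\<integral>x. g (- t) * (modul s x * h x) \<partial>lebesgue)"
        by (intro Bochner_Integration.integral_cong) (auto simp: mult_ac)
      then show ?thesis by (simp add: norm_mult)
    qed
    ultimately show "(\<Sum>(t, s)\<in>F. cmod (c (t, s) f) * (cmod (g (- t)) * cmod (\<integral>x. modul s x * h x \<partial>lebesgue)))
        \<le> K * C / c0 * lp_norm p f * lp_norm q h" by simp
  next
    fix f h and e :: real assume f: "f \<in> Lp p" and h: "h \<in> Lp q" "\<forall>x. x \<notin> {0..l} \<longrightarrow> h x = 0"
      and e: "0 < e"
    obtain F0 where F0: "finite F0" "F0 \<subseteq> \<Lambda>" "\<And>F. finite F \<Longrightarrow> F0 \<subseteq> F \<Longrightarrow> F \<subseteq> \<Lambda> \<Longrightarrow>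
        cmod ((\<integral>x. f x * h x \<partial>lebesgue) - (\<Sum>n\<in>F. c n f *
          (\<integral>x. (case n of (t, s) \<Rightarrow> \<lambda>x. modul s x * transl t g x) x * h x \<partial>lebesgue))) \<le> e"
      using frame_pairing_approximation[OF pq frame f h(1) e] by blast
    have main: "cmod (\<integral>x. f x * h x \<partial>lebesgue) \<le> e + 1/4 * lp_norm p f * lp_norm q h +
        (\<Sum>(t, s)\<in>F. cmod (c (t, s) f) * (cmod (g (- t)) * cmod (\<integral>x. modul s x * h x \<partial>lebesgue)))"
      if F: "finite F" "F0 \<subseteq> F" "F \<subseteq> \<Lambda>" for F
    proof -
      define I where "I t s = (\<integral>x. (modul s x * transl t g x) * h x \<partial>lebesgue)" for t s
      \<comment> \<open>\<open>R\<close> collects the error of freezing the window at x = 0, and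
        \<open>J\<close> is the pairing with the pure exponential, so
        \<open>I t s = g (- t) * J s + R t s\<close>.\<close>
      define R where "R t s = (\<integral>x. modul s x * ((g (x - t) - g (- t)) * h x) \<partial>lebesgue)" for t s
      define J where "J s = (\<integral>x. modul s x * h x \<partial>lebesgue)" for s
      have split: "I t s = g (- t) * J s + R t s" if "(t, s) \<in> F" for t s
      proof -
        have "(\<lambda>x. modul s x * transl t g x) \<in> Lp p"
          using frame that F by (auto simp: unconditional_schauder_frame_def)
        then have "integrable lebesgue (\<lambda>x. (modul s x * transl t g x) * h x)"
          by (rule Lp_Holder(1)[OF pq _ h(1)])
        moreover have "integrable lebesgue (\<lambda>x. modul s x * h x)"
          using h(2) l by (intro integrable_modul_mult[OF pq h(1)]) auto
        ultimately have "(\<integral>x. (modul s x * transl t g x) * h x - g (- t) * (modul s x * h x) \<partial>lebesgue)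
            = I t s - g (- t) * J s"
          by (simp add: I_def J_def)
        moreover have "(modul s x * transl t g x) * h x - g (- t) * (modul s x * h x)
            = modul s x * ((g (x - t) - g (- t)) * h x)" for x
          by (simp add: transl_def algebra_simps)
        ultimately show ?thesis by (simp add: R_def)
      qed
      have "(\<Sum>(t, s)\<in>F. cmod (c (t, s) f) * cmod (R t s)) \<le> K * \<eta> / c0 * lp_norm p f * lp_norm q h"
        unfolding R_def
        by (rule gabor_modified_window_bound[where d = d, OF _ g(1) c0 low_l K K_bound h(1) _ f _ d0 d_l F(1,3)])
          (use pq h(2) d(3)[OF fst[OF F(1,3)]] in \<open>auto intro!: continuous_intros continuous_on_compose2[OF g(1)]\<close>)
      also have "\<dots> \<le> 1/4 * lp_norm p f * lp_norm q h"
        using K\<eta> by (intro mult_right_mono lp_norm_nonneg)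
      finally have R: "(\<Sum>(t, s)\<in>F. cmod (c (t, s) f) * cmod (R t s)) \<le> 1/4 * lp_norm p f * lp_norm q h" .
      have "cmod ((\<integral>x. f x * h x \<partial>lebesgue) - (\<Sum>(t, s)\<in>F. c (t, s) f * I t s)) \<le> e"
        using F0(3)[OF F] by (simp add: I_def case_prod_beta')
      then have "cmod (\<integral>x. f x * h x \<partial>lebesgue) \<le> e + cmod (\<Sum>(t, s)\<in>F. c (t, s) f * I t s)"
        using norm_triangle_sub[of "\<integral>x. f x * h x \<partial>lebesgue" "\<Sum>(t, s)\<in>F. c (t, s) f * I t s"] by simp
      also have "cmod (\<Sum>(t, s)\<in>F. c (t, s) f * I t s)
          \<le> (\<Sum>(t, s)\<in>F. cmod (c (t, s) f) * (cmod (g (- t)) * cmod (J s)) + cmod (c (t, s) f) * cmod (R t s))"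
      proof (rule sum_norm_le, clarify)
        fix t s assume "(t, s) \<in> F"
        have "cmod (c (t, s) f * I t s) \<le> cmod (c (t, s) f) * (cmod (g (- t) * J s) + cmod (R t s))"
          unfolding norm_mult[of "c (t, s) f"] split[OF \<open>(t, s) \<in> F\<close>]
          by (intro mult_left_mono norm_triangle_ineq) auto
        then show "cmod (c (t, s) f * I t s)
          \<le> cmod (c (t, s) f) * (cmod (g (- t)) * cmod (J s)) + cmod (c (t, s) f) * cmod (R t s)"
          by (simp add: norm_mult distrib_left)
      qed
      also have "\<dots> = (\<Sum>(t, s)\<in>F. cmod (c (t, s) f) * (cmod (g (- t)) * cmod (J s)))
          + (\<Sum>(t, s)\<in>F. cmod (c (t, s) f) * cmod (R t s))"
        by (simp add: case_prod_beta' sum.distrib)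
      finally show ?thesis using R by (simp add: J_def)
    qed
    then show "\<exists>F0. finite F0 \<and> F0 \<subseteq> \<Lambda> \<and> (\<forall>F. finite F \<longrightarrow> F0 \<subseteq> F \<longrightarrow> F \<subseteq> \<Lambda> \<longrightarrow>
      cmod (\<integral>x. f x * h x \<partial>lebesgue) \<le> e + 1/4 * lp_norm p f * lp_norm q h +
        (\<Sum>(t, s)\<in>F. cmod (c (t, s) f) * (cmod (g (- t)) * cmod (\<integral>x. modul s x * h x \<partial>lebesgue))))"
      using F0(1,2) by blast
  qed
qed

section \<open>Exponentials on an interval\<close>

text \<open>The half-open steps are disjoint, so at each point at most one summand is nonzero. The
  modulus is therefore dominated by the indicator of the whole interval, whatever the signs.\<close>

lemma signed_step_function:
  fixes e :: "nat \<Rightarrow> real" and N :: nat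
  assumes p: "0 < p" and a: "0 < a" and e: "\<And>k. \<bar>e k\<bar> = 1"
  defines "f \<equiv> \<lambda>x. \<Sum>k<N. complex_of_real (e k) * indicator {real k * a..<(real k + 1) * a} x"
  shows "f \<in> Lp p" "lp_norm p f \<le> (real N * a) powr (1 / p)" "x \<notin> {0..real N * a} \<Longrightarrow> f x = 0"
proof -
  have zero: "f x = 0" if "\<And>k. k < N \<Longrightarrow> x \<notin> {real k * a..<(real k + 1) * a}" for x
    unfolding f_def by (intro sum.neutral) (use that in auto)
  have outside: "f x = 0" if "x \<notin> {0..<real N * a}" for x
  proof (rule zero)
    fix k assume "k < N"
    then have "(real k + 1) * a \<le> real N * a" "0 \<le> real k * a"
      using a by (auto intro!: mult_right_mono)
    then show "x \<notin> {real k * a..<(real k + 1) * a}" using that by auto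
  qed
  then show "f x = 0" if "x \<notin> {0..real N * a}" using that by auto
  have le: "cmod (f x) \<le> 1 * cmod (indicator {0..<real N * a} x)" for x
  proof (cases "x \<in> {0..<real N * a} \<and> (\<exists>k<N. x \<in> {real k * a..<(real k + 1) * a})")
    case True
    then obtain k where k: "k < N" "x \<in> {real k * a..<(real k + 1) * a}" by blast
    have "x \<notin> {real j * a..<(real j + 1) * a}" if "j \<noteq> k" for j
    proof
      assume "x \<in> {real j * a..<(real j + 1) * a}"
      then have "real j * a < (real k + 1) * a" "real k * a < (real j + 1) * a"
        using k(2) by auto
      then show False using a that by simp
    qed
    then have "f x = (\<Sum>j<N. if j = k then complex_of_real (e k) else 0)"
      unfolding f_def using k by (intro sum.cong) auto
    then show ?thesis using k(1) e True by simp
  next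
    case False
    then have "f x = 0" using outside[of x] zero[of x] by blast
    then show ?thesis by simp
  qed
  have "f \<in> borel_measurable lebesgue"
    unfolding f_def by (intro borel_measurable_sum borel_measurable_times borel_measurable_indicator) auto
  note dom = Lp_dominated[OF p indicator_Lp(1)[OF p, of 0 "real N * a"] this _ le]
  show "f \<in> Lp p" using dom(1) a by simp
  show "lp_norm p f \<le> (real N * a) powr (1 / p)"
    using dom(2) a indicator_Lp(2)[OF p, of 0 "real N * a"] by simp
qed

lemma powr_nat_unbounded:
  assumes "0 < \<gamma>" shows "\<exists>N\<ge>1. B < real N powr \<gamma>"
proof -
  obtain N where N: "max 1 (max 1 B powr (1 / \<gamma>)) < real N" using reals_Archimedean2 by blast
  then have "(max 1 B powr (1 / \<gamma>)) powr \<gamma> < real N powr \<gamma>"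
    using assms by (intro powr_less_mono2) auto
  then show ?thesis using N assms by (intro exI[of _ N]) (auto simp: powr_powr)
qed

text \<open>The pairings of \<open>e\<^sub>s\<close> with the indicators of the \<open>N\<close> subintervals of length \<open>l / N\<close> all have the same
  modulus. A random signed sum of these indicators, tested against a single one, therefore gains a factor
  \<open>\<surd>N\<close>. The random sum is placed on the side of the exponent larger than 2.\<close>

lemma no_unconditional_exponential_system:
  fixes c :: "real \<times> real \<Rightarrow> (real \<Rightarrow> complex) \<Rightarrow> complex" and \<gamma> :: "real \<Rightarrow> real"
  assumes pq: "1 < p" "1 < q" "1 / p + 1 / q = 1" and p2: "p \<noteq> 2"
    and l: "0 < l" and \<gamma>: "\<And>t. 0 \<le> \<gamma> t" and dual: "\<And>n. n \<in> \<Lambda> \<Longrightarrow> c n \<in> Lp_dual p"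
    and upper: "\<And>f h F. f \<in> Lp p \<Longrightarrow> h \<in> Lp q \<Longrightarrow> (\<And>x. x \<notin> {0..l} \<Longrightarrow> h x = 0) \<Longrightarrow> finite F \<Longrightarrow> F \<subseteq> \<Lambda> \<Longrightarrow>
      (\<Sum>(t, s)\<in>F. cmod (c (t, s) f) * (\<gamma> t * cmod (\<integral>x. modul s x * h x \<partial>lebesgue)))
        \<le> K * lp_norm p f * lp_norm q h"
    and lower: "\<And>f h e. f \<in> Lp p \<Longrightarrow> h \<in> Lp q \<Longrightarrow> (\<And>x. x \<notin> {0..l} \<Longrightarrow> h x = 0) \<Longrightarrow> 0 < e \<Longrightarrow>
      \<exists>F0. finite F0 \<and> F0 \<subseteq> \<Lambda> \<and> (\<forall>F. finite F \<longrightarrow> F0 \<subseteq> F \<longrightarrow> F \<subseteq> \<Lambda> \<longrightarrow>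
        cmod (\<integral>x. f x * h x \<partial>lebesgue) \<le> e + 1/4 * lp_norm p f * lp_norm q h +
          (\<Sum>(t, s)\<in>F. cmod (c (t, s) f) * (\<gamma> t * cmod (\<integral>x. modul s x * h x \<partial>lebesgue))))"
    and K: "0 \<le> K"
  shows False
proof -
  \<comment> \<open>1/p and 1/q have mean 1/2, so p \<noteq> 2 is exactly what puts the larger one
    above 1/2.\<close>
  define r where "r = max (1 / p) (1 / q)"
  have r: "1 / 2 < r"
  proof -
    have "1 / p \<noteq> 1 / 2" using p2 pq by simp
    then show ?thesis using pq(3) unfolding r_def by linarith
  qed
  have bound: "real N powr (r - 1 / 2) \<le> 4 * K" if N: "1 \<le> N" for N :: nat
  proof -
    define a where "a = l / real N"
    have a: "0 < a" and Na: "real N * a = l" using l N by (simp_all add: a_def)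
    define \<phi> where "\<phi> k x = (indicator {real k * a..<(real k + 1) * a} x :: complex)" for k x
    have \<phi>L: "\<phi> k \<in> Lp p'" and \<phi>_norm: "lp_norm p' (\<phi> k) = a powr (1 / p')" if "0 < p'" for k p'
      unfolding \<phi>_def using indicator_Lp[OF that, of "real k * a" "(real k + 1) * a"] a
      by (simp_all add: algebra_simps)
    have \<phi>_supp: "\<phi> k x = 0" if "k < N" "x \<notin> {0..l}" for k x
    proof -
      have "(real k + 1) * a \<le> real N * a" "0 \<le> real k * a"
        using a that(1) by (auto intro!: mult_right_mono)
      then show ?thesis using that(2) Na by (auto simp: \<phi>_def indicator_def)
    qed
    have \<phi>\<phi>: "(\<integral>x. \<phi> k x * \<phi> k x \<partial>lebesgue) = a" for k
    proof -
      have "\<phi> k x * \<phi> k x = indicator {real k * a..<(real k + 1) * a} x *\<^sub>R (1 :: complex)" for x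
        by (simp add: \<phi>_def indicator_def)
      then show ?thesis using a by (simp add: algebra_simps scaleR_conv_of_real)
    qed
    define m where "m s = cmod (\<integral>x. modul s x * \<phi> 0 x \<partial>lebesgue)" for s
    have m: "cmod (\<integral>x. modul s x * \<phi> k x \<partial>lebesgue) = m s" for s k
    proof -
      have "(\<integral>x. modul s x * \<phi> k x \<partial>lebesgue) = (\<integral>x. modul s (x + real k * a) * \<phi> k (x + real k * a) \<partial>lebesgue)"
        by (rule integral_lebesgue_shift[symmetric])
      also have "\<dots> = (\<integral>x. modul s (real k * a) * (modul s x * \<phi> 0 x) \<partial>lebesgue)"
        by (intro Bochner_Integration.integral_cong refl)
          (auto simp: modul_add \<phi>_def indicator_def algebra_simps)
      finally show ?thesis by (simp add: norm_mult m_def)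
    qed
    have m0: "0 \<le> m s" for s by (simp add: m_def)
    have step: "(\<lambda>x. \<Sum>k<N. complex_of_real (e k) * \<phi> k x) \<in> Lp p'"
        "lp_norm p' (\<lambda>x. \<Sum>k<N. complex_of_real (e k) * \<phi> k x) \<le> l powr (1 / p')"
        "x \<notin> {0..l} \<Longrightarrow> (\<Sum>k<N. complex_of_real (e k) * \<phi> k x) = 0"
      if "0 < p'" "\<forall>k. \<bar>e k\<bar> = 1" for p' x and e :: "nat \<Rightarrow> real"
    proof -
      note S = signed_step_function[where N = N and e = e, OF that(1) a that(2)[rule_format], folded \<phi>_def, unfolded Na]
      show "(\<lambda>x. \<Sum>k<N. complex_of_real (e k) * \<phi> k x) \<in> Lp p'" by (rule S(1))
      show "lp_norm p' (\<lambda>x. \<Sum>k<N. complex_of_real (e k) * \<phi> k x) \<le> l powr (1 / p')" by (rule S(2))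
      show "x \<notin> {0..l} \<Longrightarrow> (\<Sum>k<N. complex_of_real (e k) * \<phi> k x) = 0" by (rule S(3))
    qed
    \<comment> \<open>For f = h = \<open>\<phi> k\<close> the integral is a, and so is the product
      of the two norms. The freezing error and the choice e = a/4 take a/4 each, leaving
      a/2.\<close>
    have "\<exists>F0. finite F0 \<and> F0 \<subseteq> \<Lambda> \<and> (\<forall>F. finite F \<longrightarrow> F0 \<subseteq> F \<longrightarrow> F \<subseteq> \<Lambda> \<longrightarrow>
        a / 2 \<le> (\<Sum>(t, s)\<in>F. cmod (c (t, s) (\<phi> k)) * (\<gamma> t * m s)))" if k: "k < N" for k
    proof -
      have "a powr (1 / p) * a powr (1 / q) = a" using a pq by (simp add: powr_add[symmetric])
      then have norms: "1/4 * lp_norm p (\<phi> k) * lp_norm q (\<phi> k) = a / 4"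
        using pq by (simp add: \<phi>_norm)
      obtain F0 where F0: "finite F0" "F0 \<subseteq> \<Lambda>" and le: "\<forall>F. finite F \<longrightarrow> F0 \<subseteq> F \<longrightarrow> F \<subseteq> \<Lambda> \<longrightarrow>
          cmod (\<integral>x. \<phi> k x * \<phi> k x \<partial>lebesgue) \<le> a / 4 + 1/4 * lp_norm p (\<phi> k) * lp_norm q (\<phi> k) +
            (\<Sum>(t, s)\<in>F. cmod (c (t, s) (\<phi> k)) * (\<gamma> t * cmod (\<integral>x. modul s x * \<phi> k x \<partial>lebesgue)))"
        using lower[OF \<phi>L[of p k] \<phi>L[of q k] \<phi>_supp[OF k], of "a / 4"] pq a by auto
      have "a / 2 \<le> (\<Sum>(t, s)\<in>F. cmod (c (t, s) (\<phi> k)) * (\<gamma> t * m s))"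
        if "finite F" "F0 \<subseteq> F" "F \<subseteq> \<Lambda>" for F
        using le[rule_format, OF that] a unfolding norms m \<phi>\<phi> by simp
      then show ?thesis using F0 by blast
    qed
    then have "\<forall>k\<in>{..<N}. \<exists>F0. finite F0 \<and> F0 \<subseteq> \<Lambda> \<and> (\<forall>F. finite F \<longrightarrow> F0 \<subseteq> F \<longrightarrow> F \<subseteq> \<Lambda> \<longrightarrow>
        a / 2 \<le> (\<Sum>(t, s)\<in>F. cmod (c (t, s) (\<phi> k)) * (\<gamma> t * m s)))" by simp
    from bchoice[OF this] obtain F0 where F0: "\<forall>k\<in>{..<N}. finite (F0 k) \<and> F0 k \<subseteq> \<Lambda> \<and>
        (\<forall>F. finite F \<longrightarrow> F0 k \<subseteq> F \<longrightarrow> F \<subseteq> \<Lambda> \<longrightarrow>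
          a / 2 \<le> (\<Sum>(t, s)\<in>F. cmod (c (t, s) (\<phi> k)) * (\<gamma> t * m s)))" ..
    \<comment> \<open>Signs are chosen for one finite index set, which must carry the lower bounds
      for all k < N; these persist on supersets of \<open>F0 k\<close>.\<close>
    define F where "F = (\<Union>k<N. F0 k)"
    have F: "finite F" "F \<subseteq> \<Lambda>" using F0 by (auto simp: F_def)
    have F_low: "a / 2 \<le> (\<Sum>(t, s)\<in>F. cmod (c (t, s) (\<phi> k)) * (\<gamma> t * m s))" if "k < N" for k
    proof -
      have "F0 k \<subseteq> F" using that by (auto simp: F_def)
      then show ?thesis using F0 F that by simp
    qed
    \<comment> \<open>With a = l / N this says that N^(r - 1/2) <= 4 K. One factor 2 comes from
      Khintchine, the other from the a/2 in the lower bound.\<close>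
    have "sqrt N * a \<le> 4 * K * l * real N powr - r"
    proof (cases "1 / q < 1 / p")
      case True
      \<comment> \<open>Case p < 2: \<open>\<phi> 0\<close> is expanded and the signed sum is the
        test function in L^q. All N pairings have modulus \<open>m s\<close>, so their square
        function is exactly sqrt N times \<open>m s\<close>.\<close>
      define w where "w = (\<lambda>(t, s). cmod (c (t, s) (\<phi> 0)) * \<gamma> t)"
      have w: "0 \<le> w n" for n using \<gamma> by (simp add: w_def split: prod.split)
      obtain e :: "nat \<Rightarrow> real" where e: "\<forall>k. \<bar>e k\<bar> = 1"
        "(\<Sum>n\<in>F. w n * sqrt (\<Sum>k<N. cmod (\<integral>x. modul (snd n) x * \<phi> k x \<partial>lebesgue)^2))
          \<le> 2 * (\<Sum>n\<in>F. w n * cmod (\<Sum>k<N. e k * (\<integral>x. modul (snd n) x * \<phi> k x \<partial>lebesgue)))"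
        using signs_Khintchine[of "{..<N}" F w "\<lambda>k n. \<integral>x. modul (snd n) x * \<phi> k x \<partial>lebesgue"] w by auto
      define h where "h = (\<lambda>x. \<Sum>k<N. complex_of_real (e k) * \<phi> k x)"
      have h: "h \<in> Lp q" "lp_norm q h \<le> l powr (1 / q)" "\<And>x. x \<notin> {0..l} \<Longrightarrow> h x = 0"
        unfolding h_def using step[of q e] e(1) pq by auto
      have pair: "(\<Sum>k<N. e k * (\<integral>x. modul s x * \<phi> k x \<partial>lebesgue)) = (\<integral>x. modul s x * h x \<partial>lebesgue)" for s
      proof -
        have "integrable lebesgue (\<lambda>x. modul s x * \<phi> k x)" if "k < N" for k
          using integrable_modul_mult[OF pq \<phi>L \<phi>_supp[OF that]] pq l by simp
        moreover have "(\<lambda>x. modul s x * h x) = (\<lambda>x. \<Sum>k<N. e k * (modul s x * \<phi> k x))"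
          by (simp add: h_def sum_distrib_left mult_ac)
        ultimately show ?thesis by simp
      qed
      have "sqrt N * (a / 2) \<le> sqrt N * (\<Sum>(t, s)\<in>F. cmod (c (t, s) (\<phi> 0)) * (\<gamma> t * m s))"
        using F_low[of 0] N by (intro mult_left_mono) auto
      also have "\<dots> = (\<Sum>n\<in>F. w n * sqrt (\<Sum>k<N. cmod (\<integral>x. modul (snd n) x * \<phi> k x \<partial>lebesgue)^2))"
        unfolding sum_distrib_left m
        by (intro sum.cong refl) (auto simp: w_def real_sqrt_mult m0 split: prod.split)
      also have "\<dots> \<le> 2 * (\<Sum>n\<in>F. w n * cmod (\<integral>x. modul (snd n) x * h x \<partial>lebesgue))"
        using e(2) unfolding pair .
      also have "\<dots> = 2 * (\<Sum>(t, s)\<in>F. cmod (c (t, s) (\<phi> 0)) * (\<gamma> t * cmod (\<integral>x. modul s x * h x \<partial>lebesgue)))"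
        by (simp add: w_def case_prod_beta' mult.assoc)
      also have "\<dots> \<le> 2 * (K * lp_norm p (\<phi> 0) * lp_norm q h)"
        using upper[OF \<phi>L h(1,3) F] pq by simp
      also have "\<dots> \<le> 2 * (K * a powr (1 / p) * l powr (1 / q))"
        using h(2) K pq by (simp add: \<phi>_norm mult_left_mono)
      also have "a powr (1 / p) = l powr (1 / p) * real N powr - r"
        using True l by (simp add: a_def powr_divide r_def powr_minus_divide)
      finally have "sqrt N * a \<le> 4 * K * (l powr (1 / p) * l powr (1 / q)) * real N powr - r"
        by (simp add: mult_ac)
      then show ?thesis using pq l by (simp add: powr_add[symmetric])
    next
      case False
      \<comment> \<open>Case p > 2: the signed sum is expanded in L^p and tested against
        \<open>\<phi> 0\<close>.\<close>
      define w where "w = (\<lambda>(t, s). \<gamma> t * m s)"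
      have w: "0 \<le> w n" for n using \<gamma> by (simp add: w_def m_def split: prod.split)
      obtain e :: "nat \<Rightarrow> real" where e: "\<forall>k. \<bar>e k\<bar> = 1"
        "(\<Sum>n\<in>F. w n * sqrt (\<Sum>k<N. cmod (c n (\<phi> k))^2)) \<le> 2 * (\<Sum>n\<in>F. w n * cmod (\<Sum>k<N. e k * c n (\<phi> k)))"
        using signs_Khintchine[of "{..<N}" F w "\<lambda>k n. c n (\<phi> k)"] w by auto
      define f where "f = (\<lambda>x. \<Sum>k<N. complex_of_real (e k) * \<phi> k x)"
      have f: "f \<in> Lp p" "lp_norm p f \<le> l powr (1 / p)"
        unfolding f_def using step[of p e] e(1) pq by auto
      have cf: "(\<Sum>k<N. e k * c n (\<phi> k)) = c n f" if "n \<in> F" for n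
        unfolding f_def using that F pq by (intro Lp_dual_sum[symmetric, where p = p] dual \<phi>L) auto
      \<comment> \<open>The coefficients of different \<open>\<phi> k\<close> need not have equal
        moduli. Adding the N lower bounds gains N, and Cauchy-Schwarz gives back only sqrt
        N.\<close>
      have CS: "(\<Sum>k<N. cmod (c n (\<phi> k))) \<le> sqrt N * sqrt (\<Sum>k<N. cmod (c n (\<phi> k))^2)" for n
        using L2_set_mult_ineq[of "\<lambda>k. 1" "\<lambda>k. cmod (c n (\<phi> k))" "{..<N}"] by (simp add: L2_set_def)
      have "sqrt N * (sqrt N * (a / 2)) = (\<Sum>k<N. a / 2)"
        by (simp add: mult.assoc[symmetric])
      also have "\<dots> \<le> (\<Sum>k<N. \<Sum>(t, s)\<in>F. cmod (c (t, s) (\<phi> k)) * (\<gamma> t * m s))"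
        by (intro sum_mono F_low) auto
      also have "\<dots> = (\<Sum>n\<in>F. w n * (\<Sum>k<N. cmod (c n (\<phi> k))))"
        by (subst sum.swap) (simp add: w_def case_prod_beta' sum_distrib_left mult_ac)
      also have "\<dots> \<le> (\<Sum>n\<in>F. w n * (sqrt N * sqrt (\<Sum>k<N. cmod (c n (\<phi> k))^2)))"
        by (intro sum_mono mult_left_mono CS w)
      also have "\<dots> = sqrt N * (\<Sum>n\<in>F. w n * sqrt (\<Sum>k<N. cmod (c n (\<phi> k))^2))"
        by (simp add: sum_distrib_left mult.left_commute)
      finally have "sqrt N * (a / 2) \<le> (\<Sum>n\<in>F. w n * sqrt (\<Sum>k<N. cmod (c n (\<phi> k))^2))"
        using N by simp
      also have "\<dots> \<le> 2 * (\<Sum>n\<in>F. w n * cmod (c n f))"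
        using e(2) cf by (simp cong: sum.cong)
      also have "(\<Sum>n\<in>F. w n * cmod (c n f))
          = (\<Sum>(t, s)\<in>F. cmod (c (t, s) f) * (\<gamma> t * cmod (\<integral>x. modul s x * \<phi> 0 x \<partial>lebesgue)))"
        by (simp add: w_def case_prod_beta' m_def mult_ac)
      also have "\<dots> \<le> K * lp_norm p f * lp_norm q (\<phi> 0)"
        using pq N by (intro upper f(1) \<phi>L \<phi>_supp F) auto
      also have "\<dots> \<le> K * l powr (1 / p) * a powr (1 / q)"
        using f(2) K pq by (simp add: \<phi>_norm mult_left_mono mult_right_mono)
      also have "a powr (1 / q) = l powr (1 / q) * real N powr - r"
        using False l by (simp add: a_def powr_divide r_def powr_minus_divide max_def)
      finally have "sqrt N * a \<le> 4 * K * (l powr (1 / p) * l powr (1 / q)) * real N powr - r"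
        by (simp add: mult_ac)
      then show ?thesis using pq l by (simp add: powr_add[symmetric])
    qed
    then have "l * (sqrt N / real N) \<le> l * (4 * K * real N powr - r)"
      by (simp add: a_def mult_ac)
    then have "sqrt N / real N \<le> 4 * K * real N powr - r"
      using l by (simp only: mult_le_cancel_left_pos)
    moreover have "sqrt N / real N = real N powr (- 1 / 2)"
      using N powr_diff[of "real N" "1/2" 1] by (simp add: powr_half_sqrt)
    ultimately have "real N powr (- 1 / 2) * real N powr r \<le> 4 * K * real N powr - r * real N powr r"
      by (intro mult_right_mono) auto
    then show ?thesis using N by (simp add: powr_add[symmetric] mult.assoc)
  qed
  obtain N :: nat where "1 \<le> N" "4 * K < real N powr (r - 1 / 2)"
    using powr_nat_unbounded[of "r - 1 / 2"] r by auto
  then show False using bound[of N] by simp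
qed

theorem theorem2p3:
  fixes p :: real and g :: "real \<Rightarrow> complex" and T :: "real set"
    and \<Lambda> :: "(real \<times> real) set"
  assumes "1 < p" and "p \<noteq> 2"
    and "continuous_on UNIV g" and "wiener_amalgam g"
    and "uniformly_discrete T"
    and "\<Lambda> \<subseteq> T \<times> UNIV" and "countable \<Lambda>"
  shows "\<not> (\<exists>gstar :: real \<times> real \<Rightarrow> (real \<Rightarrow> complex) \<Rightarrow> complex.
             (\<forall>ts\<in>\<Lambda>. gstar ts \<in> Lp_dual p) \<and>
             unconditional_schauder_frame p \<Lambda>
               (\<lambda>(t, s). \<lambda>x. modul s x * transl t g x) gstar)"
proof (rule notI, elim exE conjE)
  fix c :: "real \<times> real \<Rightarrow> (real \<Rightarrow> complex) \<Rightarrow> complex"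
  assume dual: "\<forall>ts\<in>\<Lambda>. c ts \<in> Lp_dual p"
    and frame: "unconditional_schauder_frame p \<Lambda> (\<lambda>(t, s). \<lambda>x. modul s x * transl t g x) c"
  define q where "q = p / (p - 1)"
  have q: "1 < q" "1 / p + 1 / q = 1" using assms(1) by (simp_all add: q_def field_simps)
  obtain l K where lK: "0 < l" "0 \<le> K"
    and loc: "\<forall>f\<in>Lp p. \<forall>h\<in>Lp q. (\<forall>x. x \<notin> {0..l} \<longrightarrow> h x = 0) \<longrightarrow>
    (\<forall>F. finite F \<longrightarrow> F \<subseteq> \<Lambda> \<longrightarrow>
      (\<Sum>(t, s)\<in>F. cmod (c (t, s) f) * (cmod (g (- t)) * cmod (\<integral>x. modul s x * h x \<partial>lebesgue)))
        \<le> K * lp_norm p f * lp_norm q h) \<and>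
    (\<forall>e>0. \<exists>F0. finite F0 \<and> F0 \<subseteq> \<Lambda> \<and> (\<forall>F. finite F \<longrightarrow> F0 \<subseteq> F \<longrightarrow> F \<subseteq> \<Lambda> \<longrightarrow>
      cmod (\<integral>x. f x * h x \<partial>lebesgue) \<le> e + 1/4 * lp_norm p f * lp_norm q h +
        (\<Sum>(t, s)\<in>F. cmod (c (t, s) f) * (cmod (g (- t)) * cmod (\<integral>x. modul s x * h x \<partial>lebesgue)))))"
    using gabor_frame_localization[OF assms(1) q assms(3-6) frame] by (elim exE conjE) (rule that)
  show False
    by (rule no_unconditional_exponential_system[OF assms(1) q assms(2) lK(1), where \<gamma> = "\<lambda>t. cmod (g (- t))" and c = c and \<Lambda> = \<Lambda> and K = K])
      (use dual lK loc in simp_all)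
qed

end
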